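(* Let $K$ be a field, let $X$ be a finite braided rack of conjugacy type, and let $q\equiv -1$ be the constant $2$-cocycle on $X$ with value $-1\in K^\times$. Then the Nichols algebra $\mathcal{B}(X,q)$ over $K$ satisfies $\Gamma_2(\mathcal{B}(X,q))=\emptyset$, that is, $\mathcal{B}(X,q)$ has no $2$-truncated point modules.
   Context: A rack is a set $X$ with a binary operation $\triangleright$ such that every map $y\mapsto x\triangleright y$ is bijective and $x\triangleright(y\triangleright z)=(x\triangleright y)\triangleright(x\triangleright z)$ for all $x,y,z\in X$. It is of conjugacy type if it is isomorphic to a union of conjugacy classes of a group with $x\triangleright y=xyx^{-1}$; throughout, all racks are of conjugacy type. A rack $X$ is braided if $x\triangleright x=x$ for all $x\in X$ and, for all $x,y\in X$, either $x\triangleright(y\triangleright x)=y$ or $x\triangleright y=y$. Nichols algebras. A $2$-cocycle of a finite rack $X$ over $K$ is a map $q\colon X\times X\to K^\times$, $(x,y)\mapsto q_{x,y}$, with $q_{x,y\triangleright z}\,q_{y,z}=q_{x\triangleright y,x\triangleright z}\,q_{x,z}$ for all $x,y,z\in X$. Let $V=KX$ be the vector space with basis $X$ and let $c\in \mathrm{GL}(V\otimes V)$, $c(x\otimes y)=q_{x,y}\,(x\triangleright y)\otimes x$. On $V^{\otimes n}$ let $c_i$ act as $c$ on the tensor factors $i,i+1$ and as the identity elsewhere. Define $\mathcal{S}_1=I$ and $\mathcal{S}_{n+1}=(I\otimes\mathcal{S}_n)(I+c_1+c_1c_2+\cdots+c_1c_2\cdots c_n)$; in particular $\mathcal{S}_2=I+c_1$.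 The Nichols algebra is the graded algebra $\mathcal{B}(X,q)=K\oplus V\oplus\bigoplus_{n\ge 2}V^{\otimes n}/\ker\mathcal{S}_n$, a quotient of the tensor algebra $T(V)$. Truncated point modules. For a connected graded $K$-algebra $A$ generated in degree one by finitely many elements, an $n$-truncated point module is a graded (left) $A$-module generated in degree $0$ with Hilbert series $1+t+\cdots+t^n$. $\Gamma_n(A)$ denotes the set of $n$-truncated point modules over $A$ up to graded isomorphism. *)

theory Defs
  imports Complex_Main "HOL-Algebra.QuotRing" "HOL-Algebra.Module"
begin

section \<open>Racks\<close>

locale rack =
  fixes X :: "'x set" and tri :: "'x \<Rightarrow> 'x \<Rightarrow> 'x" (infixr "\<triangleright>" 70)
  assumes bij_tri: "x \<in> X \<Longrightarrow> bij_betw (\<lambda>y. x \<triangleright> y) X X"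
    and self_distrib:
      "\<lbrakk>x \<in> X; y \<in> X; z \<in> X\<rbrakk> \<Longrightarrow> x \<triangleright> (y \<triangleright> z) = (x \<triangleright> y) \<triangleright> (x \<triangleright> z)"

locale braided_rack = rack +
  assumes idem: "x \<in> X \<Longrightarrow> x \<triangleright> x = x"
    and braided: "\<lbrakk>x \<in> X; y \<in> X\<rbrakk> \<Longrightarrow> x \<triangleright> (y \<triangleright> x) = y \<or> x \<triangleright> y = y"

definition conjugacy_class :: "('g, 'h) monoid_scheme \<Rightarrow> 'g \<Rightarrow> 'g set" where
  "conjugacy_class G h = {g \<otimes>\<^bsub>G\<^esub> h \<otimes>\<^bsub>G\<^esub> inv\<^bsub>G\<^esub> g | g. g \<in> carrier G}"

text \<open>HOL cannot quantify existentially over the type of the ambient group, so the group is a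
  parameter; a theorem assuming \<open>of_conjugacy_type G X tri\<close> for a universally quantified \<open>G\<close>
  covers every rack that is of conjugacy type with respect to some group.\<close>

definition of_conjugacy_type ::
    "('g, 'h) monoid_scheme \<Rightarrow> 'x set \<Rightarrow> ('x \<Rightarrow> 'x \<Rightarrow> 'x) \<Rightarrow> bool" where
  "of_conjugacy_type G X tri \<longleftrightarrow> group G \<and>
     (\<exists>H \<phi>. H \<subseteq> carrier G \<and> bij_betw \<phi> X (\<Union>h\<in>H. conjugacy_class G h) \<and>
        (\<forall>x\<in>X. \<forall>y\<in>X. \<phi> (tri x y) = \<phi> x \<otimes>\<^bsub>G\<^esub> \<phi> y \<otimes>\<^bsub>G\<^esub> inv\<^bsub>G\<^esub> (\<phi> x)))"

definition rack_2_cocycle ::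
    "'x set \<Rightarrow> ('x \<Rightarrow> 'x \<Rightarrow> 'x) \<Rightarrow> ('x \<Rightarrow> 'x \<Rightarrow> 'k::field) \<Rightarrow> bool" where
  "rack_2_cocycle X tri q \<longleftrightarrow>
     (\<forall>x\<in>X. \<forall>y\<in>X. q x y \<noteq> 0) \<and>
     (\<forall>x\<in>X. \<forall>y\<in>X. \<forall>z\<in>X. q x (tri y z) * q y z = q (tri x y) (tri x z) * q x z)"


section \<open>Graded algebras over a field\<close>

text \<open>The ground field is the type \<open>'k\<close>; the \<^const>\<open>smult\<close> of the record is scalar
  multiplication on the algebra, and \<open>acomp A n\<close> is the homogeneous component of degree \<open>n\<close>.\<close>

record ('k, 'a) graded_algebra = "('k, 'a) module" +
  acomp :: "nat \<Rightarrow> 'a set"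


section \<open>The tensor algebra\<close>

text \<open>The word \<open>[x1, \<dots>, xn]\<close> stands for the basis vector \<open>x1 \<otimes> \<dots> \<otimes> xn\<close> of
  \<open>V^{\<otimes>n}\<close> with \<open>V = KX\<close>, and a tensor is its coefficient function on words.\<close>

definition tensor_carrier :: "'x set \<Rightarrow> ('x list \<Rightarrow> 'k::field) set" where
  "tensor_carrier X = {f. finite {w. f w \<noteq> 0} \<and> (\<forall>w. f w \<noteq> 0 \<longrightarrow> set w \<subseteq> X)}"

definition tensor_algebra :: "'x set \<Rightarrow> ('k::field, 'x list \<Rightarrow> 'k) graded_algebra" where
  "tensor_algebra X =
     \<lparr>carrier = tensor_carrier X,
      mult = (\<lambda>f g w. \<Sum>i\<le>length w. f (take i w) * g (drop i w)),
      one = (\<lambda>w. if w = [] then 1 else 0),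
      zero = (\<lambda>w. 0),
      add = (\<lambda>f g w. f w + g w),
      smult = (\<lambda>a f w. a * f w),
      acomp = (\<lambda>n. {f \<in> tensor_carrier X. \<forall>w. f w \<noteq> 0 \<longrightarrow> length w = n})\<rparr>"


section \<open>Quantum symmetrizers\<close>

text \<open>\<open>braid_at tri q i\<close> is the linear operator \<open>c\<^sub>i\<close> (with \<open>i \<ge> 1\<close>); it sends the basis word
  \<open>u @ [x, y] @ v\<close> with \<open>length u = i - 1\<close> to \<open>q x y\<close> times \<open>u @ [x \<triangleright> y, x] @ v\<close>.\<close>

definition braid_word :: "('x \<Rightarrow> 'x \<Rightarrow> 'x) \<Rightarrow> nat \<Rightarrow> 'x list \<Rightarrow> 'x list" where
  "braid_word tri i w = w[i - 1 := tri (w ! (i - 1)) (w ! i), i := w ! (i - 1)]"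

definition braid_at ::
    "('x \<Rightarrow> 'x \<Rightarrow> 'x) \<Rightarrow> ('x \<Rightarrow> 'x \<Rightarrow> 'k::field) \<Rightarrow> nat \<Rightarrow> ('x list \<Rightarrow> 'k) \<Rightarrow> 'x list \<Rightarrow> 'k" where
  "braid_at tri q i f = (\<lambda>w. \<Sum>u | f u \<noteq> 0 \<and> braid_word tri i u = w. f u * q (u ! (i - 1)) (u ! i))"

text \<open>\<open>I \<otimes> F\<close>, for a linear operator \<open>F\<close> on \<open>V^{\<otimes>n}\<close>, acting on \<open>V^{\<otimes>(n+1)}\<close>.\<close>

definition id_tensor ::
    "(('x list \<Rightarrow> 'k::field) \<Rightarrow> 'x list \<Rightarrow> 'k) \<Rightarrow> ('x list \<Rightarrow> 'k) \<Rightarrow> 'x list \<Rightarrow> 'k" where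
  "id_tensor F f = (\<lambda>w. case w of [] \<Rightarrow> 0 | x # v \<Rightarrow> F (\<lambda>u. f (x # u)) v)"

text \<open>\<open>quantum_sym tri q n\<close> is the operator \<open>S\<^sub>n\<close> on \<open>V^{\<otimes>n}\<close>. Starting the recursion with
  \<open>S\<^sub>0 = I\<close> gives \<open>S\<^sub>1 = I\<close>. The \<open>foldr\<close> term is \<open>c\<^sub>1 (c\<^sub>2 (\<dots> (c\<^sub>k f)))\<close>.\<close>

primrec quantum_sym ::
    "('x \<Rightarrow> 'x \<Rightarrow> 'x) \<Rightarrow> ('x \<Rightarrow> 'x \<Rightarrow> 'k::field) \<Rightarrow> nat \<Rightarrow> ('x list \<Rightarrow> 'k) \<Rightarrow> 'x list \<Rightarrow> 'k" where
  "quantum_sym tri q 0 = (\<lambda>f. f)"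
| "quantum_sym tri q (Suc n) =
     (\<lambda>f. id_tensor (quantum_sym tri q n)
            (\<lambda>w. \<Sum>k\<le>n. foldr (braid_at tri q) [1..<Suc k] f w))"


section \<open>The Nichols algebra\<close>

definition homogeneous_part :: "nat \<Rightarrow> ('x list \<Rightarrow> 'k::field) \<Rightarrow> 'x list \<Rightarrow> 'k" where
  "homogeneous_part n f = (\<lambda>w. if length w = n then f w else 0)"

text \<open>\<open>\<Oplus>\<^sub>n ker S\<^sub>n\<close>; it vanishes in degrees 0 and 1 because \<open>S\<^sub>0\<close> and \<open>S\<^sub>1\<close> are identities.\<close>

definition nichols_ideal ::
    "'x set \<Rightarrow> ('x \<Rightarrow> 'x \<Rightarrow> 'x) \<Rightarrow> ('x \<Rightarrow> 'x \<Rightarrow> 'k::field) \<Rightarrow> ('x list \<Rightarrow> 'k) set" where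
  "nichols_ideal X tri q =
     {f \<in> tensor_carrier X. \<forall>n. quantum_sym tri q n (homogeneous_part n f) = (\<lambda>w. 0)}"

definition quotient_graded_algebra ::
    "('k, 'a) graded_algebra \<Rightarrow> 'a set \<Rightarrow> ('k, 'a set) graded_algebra" where
  "quotient_graded_algebra A I =
     ring.extend (A Quot I)
       \<lparr>smult = (\<lambda>a C. \<Union>x\<in>C. I +>\<^bsub>A\<^esub> (a \<odot>\<^bsub>A\<^esub> x)),
        acomp = (\<lambda>n. (\<lambda>x. I +>\<^bsub>A\<^esub> x) ` acomp A n)\<rparr>"

definition nichols_algebra ::
    "'x set \<Rightarrow> ('x \<Rightarrow> 'x \<Rightarrow> 'x) \<Rightarrow> ('x \<Rightarrow> 'x \<Rightarrow> 'k::field) \<Rightarrow>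
     ('k, ('x list \<Rightarrow> 'k) set) graded_algebra" where
  "nichols_algebra X tri q =
     quotient_graded_algebra (tensor_algebra X) (nichols_ideal X tri q)"


section \<open>Graded modules and truncated point modules\<close>

text \<open>The underlying abelian group of a module is a whole type \<open>'m\<close>. Modules are graded by the
  integers.\<close>

record ('a, 'm) graded_module =
  mact :: "'a \<Rightarrow> 'm \<Rightarrow> 'm"
  mcomp :: "int \<Rightarrow> 'm set"

definition left_module ::
    "('k, 'a) graded_algebra \<Rightarrow> ('a, 'm::ab_group_add) graded_module \<Rightarrow> bool" where
  "left_module A M \<longleftrightarrow>
     (\<forall>a\<in>carrier A. \<forall>m n. mact M a (m + n) = mact M a m + mact M a n) \<and>
     (\<forall>a\<in>carrier A. \<forall>b\<in>carrier A. \<forall>m. mact M (a \<oplus>\<^bsub>A\<^esub> b) m = mact M a m + mact M b m) \<and>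
     (\<forall>a\<in>carrier A. \<forall>b\<in>carrier A. \<forall>m. mact M (a \<otimes>\<^bsub>A\<^esub> b) m = mact M a (mact M b m)) \<and>
     (\<forall>m. mact M \<one>\<^bsub>A\<^esub> m = m)"

definition add_subgroup :: "'m::ab_group_add set \<Rightarrow> bool" where
  "add_subgroup N \<longleftrightarrow> 0 \<in> N \<and> (\<forall>x\<in>N. \<forall>y\<in>N. x - y \<in> N)"

definition is_graded_module ::
    "('k, 'a) graded_algebra \<Rightarrow> ('a, 'm::ab_group_add) graded_module \<Rightarrow> bool" where
  "is_graded_module A M \<longleftrightarrow> left_module A M \<and>
     (\<forall>i. add_subgroup (mcomp M i)) \<and>
     (\<forall>m. \<exists>!f. (\<forall>i. f i \<in> mcomp M i) \<and> finite {i. f i \<noteq> 0} \<and> m = (\<Sum>i | f i \<noteq> 0. f i)) \<and>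
     (\<forall>i j. \<forall>a\<in>acomp A i. \<forall>m\<in>mcomp M j. mact M a m \<in> mcomp M (int i + j))"

definition generated_in_degree_0 ::
    "('k, 'a) graded_algebra \<Rightarrow> ('a, 'm::ab_group_add) graded_module \<Rightarrow> bool" where
  "generated_in_degree_0 A M \<longleftrightarrow>
     (\<forall>N. add_subgroup N \<and> (\<forall>a\<in>carrier A. \<forall>m\<in>N. mact M a m \<in> N) \<and> mcomp M 0 \<subseteq> N
        \<longrightarrow> N = UNIV)"

text \<open>The vector space structure that a module inherits from the unit map \<open>K \<rightarrow> A\<close>.\<close>

definition mscale ::
    "('k::field, 'a) graded_algebra \<Rightarrow> ('a, 'm::ab_group_add) graded_module \<Rightarrow> 'k \<Rightarrow> 'm \<Rightarrow> 'm" where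
  "mscale A M c m = mact M (c \<odot>\<^bsub>A\<^esub> \<one>\<^bsub>A\<^esub>) m"

text \<open>The Hilbert series is \<open>1 + t + \<dots> + t^n\<close>. Components outside \<open>{0..n}\<close> are required to be
  zero explicitly, since the library's \<open>dim\<close> is also 0 on infinite-dimensional spaces.\<close>

definition truncated_point_module ::
    "nat \<Rightarrow> ('k::field, 'a) graded_algebra \<Rightarrow> ('a, 'm::ab_group_add) graded_module \<Rightarrow> bool" where
  "truncated_point_module n A M \<longleftrightarrow>
     is_graded_module A M \<and> generated_in_degree_0 A M \<and>
     (\<forall>i. if 0 \<le> i \<and> i \<le> int n
          then Vector_Spaces.vector_space.dim (mscale A M) (mcomp M i) = 1
          else mcomp M i = {0})"

definition graded_module_iso ::
    "('k, 'a) graded_algebra \<Rightarrow>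
     (('a, 'm::ab_group_add) graded_module \<times> ('a, 'm) graded_module) set" where
  "graded_module_iso A =
     {(M, N). is_graded_module A M \<and> is_graded_module A N \<and>
        (\<exists>\<phi>. bij \<phi> \<and> (\<forall>m n. \<phi> (m + n) = \<phi> m + \<phi> n) \<and>
             (\<forall>a\<in>carrier A. \<forall>m. \<phi> (mact M a m) = mact N a (\<phi> m)) \<and>
             (\<forall>i. \<phi> ` mcomp M i = mcomp N i))}"

text \<open>\<open>\<Gamma>\<^sub>n(A)\<close>, restricted to modules whose underlying abelian group is the type \<open>'m\<close>.\<close>

definition Gamma_trunc ::
    "nat \<Rightarrow> ('k::field, 'a) graded_algebra \<Rightarrow> ('a, 'm::ab_group_add) graded_module set set" where
  "Gamma_trunc n A = {M. truncated_point_module n A M} // graded_module_iso A"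

end

theory Submission
  imports Defs
begin

text \<open>A \<open>2\<close>-truncated point module provides \<open>x\<close>, \<open>m\<^sub>0\<close> with \<open>x m\<^sub>0 \<noteq> 0\<close> and \<open>y\<close>, \<open>m\<^sub>1\<close> with
  \<open>y m\<^sub>1 \<noteq> 0\<close>, where \<open>m\<^sub>i\<close> has degree \<open>i\<close>. For \<open>q = -1\<close> the kernel of \<open>S\<^sub>2\<close> contains the sum of every
  orbit of the braiding \<open>(a, b) \<mapsto> (a \<triangleright> b, a)\<close> on \<open>X \<times> X\<close>. The orbits of \<open>(x, x)\<close> and \<open>(y, y)\<close> give
  \<open>x x = y y = 0\<close>; as the component of degree 1 is a line, \<open>x\<close> annihilates it and \<open>y m\<^sub>0 = 0\<close>. In a
  braided rack the orbit of \<open>(y, x)\<close> is \<open>{(y, x), (x, y)}\<close> or \<open>{(y, x), (y \<triangleright> x, y), (x, y \<triangleright> x)}\<close>, and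
  every member except \<open>(y, x)\<close> starts with \<open>x\<close> or ends with \<open>y\<close>. Hence \<open>y (x m\<^sub>0) = 0\<close>, a
  contradiction since \<open>x m\<^sub>0\<close> spans the component of degree 1.

  For these relations to act on a module, \<open>\<Oplus>\<^sub>n ker S\<^sub>n\<close> has to be a two-sided ideal; this follows from
  factorizations of \<open>S\<^sub>n\<^sub>+\<^sub>m\<close> through \<open>S\<^sub>n \<otimes> I\<close> and \<open>I \<otimes> S\<^sub>n\<close>, the former of which uses the braid
  relation.\<close>

section \<open>Factorizations of the quantum symmetrizers\<close>

lemma id_tensor_simps [simp]:
  "id_tensor F f [] = 0"
  "id_tensor F f (x # v) = F (\<lambda>u. f (x # u)) v"
  by (simp_all add: id_tensor_def)

lemma id_tensor_comp: "id_tensor F (id_tensor G f) = id_tensor (\<lambda>f. F (G f)) f"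
proof
  show "id_tensor F (id_tensor G f) w = id_tensor (\<lambda>f. F (G f)) f w" for w
    by (cases w) auto
qed

section \<open>Braiding operators and the braid relation\<close>

locale constant_braiding =
  fixes d :: "'x \<Rightarrow> 'x \<Rightarrow> 'x" and \<kappa> :: "'k::field"
  assumes distrib: "d x (d y z) = d (d x y) (d x z)"
begin

text \<open>\<open>c i\<close> is the operator \<open>c\<^sub>i\<^sub>+\<^sub>1\<close> of a constant cocycle, written as the pull-back of coefficient
  functions along the inverse braiding; \<open>d x\<close> plays the role of the inverse of \<open>x \<triangleright> _\<close>.\<close>

primrec c :: "nat \<Rightarrow> ('x list \<Rightarrow> 'k) \<Rightarrow> 'x list \<Rightarrow> 'k" where
  "c 0 = (\<lambda>f w. case w of a # b # v \<Rightarrow> \<kappa> * f (b # d b a # v) | _ \<Rightarrow> 0)"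
| "c (Suc i) = id_tensor (c i)"

declare c.simps(1) [simp del]

lemma c_0 [simp]:
  "c 0 f [] = 0" "c 0 f [a] = 0" "c 0 f (a # b # v) = \<kappa> * f (b # d b a # v)"
  by (simp_all add: c.simps(1))

lemma word_cases:
  obtains "w = []" | a where "w = [a]" | a b v where "w = a # b # v"
  by (metis neq_Nil_conv)

lemma c_short: "length w \<le> Suc i \<Longrightarrow> c i f w = 0"
proof (induction i arbitrary: f w)
  case 0
  then show ?case by (cases w rule: word_cases) auto
next
  case (Suc i)
  then show ?case by (cases w) auto
qed

lemma c_add: "c i (\<lambda>w. f w + g w) = (\<lambda>w. c i f w + c i g w)"
proof (induction i arbitrary: f g)
  case 0
  show ?case
  proof
    show "c 0 (\<lambda>w. f w + g w) w = c 0 f w + c 0 g w" for w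
      by (cases w rule: word_cases) (auto simp: algebra_simps)
  qed
next
  case (Suc i)
  show ?case
  proof
    show "c (Suc i) (\<lambda>w. f w + g w) w = c (Suc i) f w + c (Suc i) g w" for w
      by (cases w) (auto simp: Suc)
  qed
qed

lemma c_scale: "c i (\<lambda>w. a * f w) = (\<lambda>w. a * c i f w)"
proof (induction i arbitrary: f)
  case 0
  show ?case
  proof
    show "c 0 (\<lambda>w. a * f w) w = a * c 0 f w" for w
      by (cases w rule: word_cases) (auto simp: algebra_simps)
  qed
next
  case (Suc i)
  show ?case
  proof
    show "c (Suc i) (\<lambda>w. a * f w) w = a * c (Suc i) f w" for w
      by (cases w) (auto simp: Suc)
  qed
qed

lemma c_local: "(\<And>u. length u = length w \<Longrightarrow> f u = g u) \<Longrightarrow> c i f w = c i g w"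
proof (induction i arbitrary: f g w)
  case 0
  then show ?case by (cases w rule: word_cases) auto
next
  case (Suc i)
  show ?case
  proof (cases w)
    case (Cons x v)
    then show ?thesis using Suc.prems by (auto intro!: Suc.IH)
  qed auto
qed

lemma c_append: "Suc i < length v \<Longrightarrow> c i f (v @ z) = c i (\<lambda>u. f (u @ z)) v"
proof (induction i arbitrary: f v)
  case 0
  then show ?case by (cases v rule: word_cases) auto
next
  case (Suc i)
  then show ?case by (cases v) auto
qed

text \<open>On words with at least three letters both sides read off the coefficient of a rearranged
  word, and the two words agree by \<open>distrib\<close>; shorter words get coefficient 0 on both
  sides.\<close>

lemma c_braid: "c (Suc 0) (c 0 (c (Suc 0) f)) = c 0 (c (Suc 0) (c 0 f))"
proof
  fix w
  show "c (Suc 0) (c 0 (c (Suc 0) f)) w = c 0 (c (Suc 0) (c 0 f)) w"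
  proof (cases w rule: word_cases)
    case (3 a b v)
    then show ?thesis by (cases v) (auto simp: distrib[symmetric])
  qed auto
qed

text \<open>\<open>c 0\<close> rearranges the first two letters, which
  \<open>id_tensor (id_tensor F)\<close> only carries along; homogeneity of \<open>F\<close> lets
  the factor \<open>\<kappa>\<close> pass through.\<close>

lemma c_0_id_tensor2:
  assumes "\<And>a f. F (\<lambda>w. a * f w) = (\<lambda>w. a * F f w)"
  shows "id_tensor (id_tensor F) (c 0 f) = c 0 (id_tensor (id_tensor F) f)"
proof
  show "id_tensor (id_tensor F) (c 0 f) w = c 0 (id_tensor (id_tensor F) f) w" for w
    by (cases w rule: word_cases) (auto simp: assms)
qed

text \<open>\<open>trunc\<close> is needed because \<^const>\<open>id_tensor\<close> annihilates the coefficient of the empty word,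
  so that \<open>id_tensor\<close> of the identity is not the identity.\<close>

inductive braid_op :: "nat \<Rightarrow> (('x list \<Rightarrow> 'k) \<Rightarrow> 'x list \<Rightarrow> 'k) \<Rightarrow> bool" where
  trunc: "k \<le> n \<Longrightarrow> braid_op n (\<lambda>f w. if k \<le> length w then f w else 0)"
| gen: "Suc i < n \<Longrightarrow> braid_op n (c i)"
| comp: "braid_op n F \<Longrightarrow> braid_op n G \<Longrightarrow> braid_op n (\<lambda>f. F (G f))"
| add: "braid_op n F \<Longrightarrow> braid_op n G \<Longrightarrow> braid_op n (\<lambda>f w. F f w + G f w)"

lemma braid_op_ident: "braid_op n (\<lambda>f. f)"
  using trunc[of 0 n] by simp

lemma braid_op_mono: "braid_op n F \<Longrightarrow> n \<le> m \<Longrightarrow> braid_op m F"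
  by (induction rule: braid_op.induct) (auto intro: braid_op.intros)

lemma braid_op_add: "braid_op n F \<Longrightarrow> F (\<lambda>w. f w + g w) = (\<lambda>w. F f w + F g w)"
proof (induction arbitrary: f g rule: braid_op.induct)
  case (comp n F G)
  then show ?case by simp
qed (auto simp: c_add algebra_simps)

lemma braid_op_scale: "braid_op n F \<Longrightarrow> F (\<lambda>w. a * f w) = (\<lambda>w. a * F f w)"
proof (induction arbitrary: f rule: braid_op.induct)
  case (comp n F G)
  then show ?case by simp
qed (auto simp: c_scale algebra_simps)

text \<open>Every generator relates only words of equal length, so these operators respect the
  grading by word length.\<close>

lemma braid_op_local:
  "braid_op n F \<Longrightarrow> (\<And>u. length u = length w \<Longrightarrow> f u = g u) \<Longrightarrow> F f w = F g w"
proof (induction arbitrary: f g w rule: braid_op.induct)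
  case (gen i n)
  then show ?case by (intro c_local)
next
  case (comp n F G)
  show ?case
    by (rule comp.IH(1), rule comp.IH(2), rule comp.prems) simp
next
  case (add n F G)
  show ?case
    using add.IH[OF add.prems] by simp
qed auto

lemma braid_op_zero: "braid_op n F \<Longrightarrow> F (\<lambda>w. 0) = (\<lambda>w. 0)"
  using braid_op_scale[of n F 0 "\<lambda>w. 0"] by simp

lemma braid_op_vanish:
  assumes "braid_op n F" and "\<And>u. length u = length w \<Longrightarrow> f u = 0"
  shows "F f w = 0"
  using braid_op_local[OF assms(1), of w f "\<lambda>w. 0"] braid_op_zero[OF assms(1)] assms(2) by simp

text \<open>Only the first \<open>n\<close> letters are touched; in this sense \<open>S n\<close>
  acts on longer words as S_n \<otimes> I.\<close>

lemma braid_op_append: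
  "braid_op n F \<Longrightarrow> n \<le> length v \<Longrightarrow> F f (v @ z) = F (\<lambda>u. f (u @ z)) v"
proof (induction arbitrary: f v rule: braid_op.induct)
  case (gen i n)
  then show ?case by (intro c_append) auto
next
  case (comp n F G)
  have "F (G f) (v @ z) = F (\<lambda>u. G f (u @ z)) v"
    using comp by blast
  also have "\<dots> = F (G (\<lambda>u. f (u @ z))) v"
    by (rule braid_op_local[OF comp.hyps(1)]) (use comp in auto)
  finally show ?case .
qed auto

text \<open>Generators go to generators: \<open>c i\<close> to \<open>c (Suc i)\<close>, and
  truncation at \<open>k\<close> to truncation at \<open>Suc k\<close>.\<close>

lemma braid_op_id_tensor: "braid_op n F \<Longrightarrow> braid_op (Suc n) (id_tensor F)"
proof (induction rule: braid_op.induct)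
  case (trunc k n)
  have "id_tensor (\<lambda>f w. if k \<le> length w then f w else 0) =
      (\<lambda>(f :: 'x list \<Rightarrow> 'k) w. if Suc k \<le> length w then f w else 0)"
  proof (intro ext)
    fix f :: "'x list \<Rightarrow> 'k" and w
    show "id_tensor (\<lambda>f w. if k \<le> length w then f w else 0) f w =
      (if Suc k \<le> length w then f w else 0)"
      by (cases w) auto
  qed
  then show ?case using braid_op.trunc[of "Suc k" "Suc n"] trunc by simp
next
  case (gen i n)
  then show ?case using braid_op.gen[of "Suc i" "Suc n"] by simp
next
  case (comp n F G)
  have "(\<lambda>f. id_tensor F (id_tensor G f)) = id_tensor (\<lambda>f. F (G f))"
    by (simp add: id_tensor_comp fun_eq_iff)
  then show ?case using braid_op.comp[OF comp.IH] by simp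
next
  case (add n F G)
  have "(\<lambda>f w. id_tensor F f w + id_tensor G f w) = id_tensor (\<lambda>f w. F f w + G f w)"
  proof (intro ext)
    fix f w
    show "id_tensor F f w + id_tensor G f w = id_tensor (\<lambda>f w. F f w + G f w) f w"
      by (cases w) auto
  qed
  then show ?case using braid_op.add[OF add.IH] by simp
qed

section \<open>Products of braidings and the symmetrizers they form\<close>

primrec P :: "nat \<Rightarrow> ('x list \<Rightarrow> 'k) \<Rightarrow> 'x list \<Rightarrow> 'k" where
  "P 0 = (\<lambda>f. f)"
| "P (Suc n) = (\<lambda>f. P n (c n f))"

text \<open>As \<open>P k\<close> is c_1 ... c_k, this is the bracket I + c_1 + ... + c_1...c_n in
  the recursion for S_{n+1}.\<close>

definition T :: "nat \<Rightarrow> ('x list \<Rightarrow> 'k) \<Rightarrow> 'x list \<Rightarrow> 'k" where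
  "T n = (\<lambda>f w. \<Sum>k\<le>n. P k f w)"

primrec S :: "nat \<Rightarrow> ('x list \<Rightarrow> 'k) \<Rightarrow> 'x list \<Rightarrow> 'k" where
  "S 0 = (\<lambda>f. f)"
| "S (Suc n) = (\<lambda>f. id_tensor (S n) (T n f))"

lemma T_0: "T 0 = (\<lambda>f. f)"
  by (simp add: T_def)

lemma T_Suc: "T (Suc n) = (\<lambda>f w. T n f w + P (Suc n) f w)"
  by (simp add: T_def)

lemma braid_op_P: "k < n \<Longrightarrow> braid_op n (P k)"
  by (induction k) (auto intro: braid_op_ident braid_op.intros)

lemma braid_op_T: "k < n \<Longrightarrow> braid_op n (T k)"
  by (induction k) (auto simp only: T_0 T_Suc intro: braid_op_ident braid_op.add braid_op_P)

lemma braid_op_S: "braid_op n (S n)"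
proof (induction n)
  case (Suc n)
  show ?case
    unfolding S.simps by (rule braid_op.comp[OF braid_op_id_tensor[OF Suc] braid_op_T[OF lessI]])
qed (simp add: braid_op_ident)

lemma P_Suc': "P (Suc n) f = c 0 (id_tensor (P n) f)"
proof (induction n arbitrary: f)
  case 0
  show ?case
  proof
    show "P (Suc 0) f w = c 0 (id_tensor (P 0) f) w" for w
      by (cases w rule: word_cases) auto
  qed
next
  case (Suc n)
  have "P (Suc (Suc n)) f = P (Suc n) (c (Suc n) f)"
    by (subst P.simps(2)) (rule refl)
  also have "\<dots> = c 0 (id_tensor (P n) (c (Suc n) f))"
    by (rule Suc)
  also have "\<dots> = c 0 (id_tensor (P (Suc n)) f)"
    by (simp add: id_tensor_comp)
  finally show ?case .
qed

text \<open>For \<open>i = 0\<close>, split c_1 ... c_n into c_1 c_2 and a tail from the third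
  letter on: the braid relation handles c_1 c_2, and the tail commutes with c_1. For larger
  \<open>i\<close> the operator commutes with c_1, and the induction runs on the word without its
  first letter.\<close>

lemma c_P: "Suc i < n \<Longrightarrow> c (Suc i) (P n f) = P n (c i f)"
proof (induction i arbitrary: n f)
  case 0
  then obtain m where n: "n = Suc (Suc m)"
    using less_imp_Suc_add[OF 0] by auto
  let ?P = "\<lambda>f. id_tensor (id_tensor (P m)) f"
  have P: "P n g = c 0 (c (Suc 0) (?P g))" for g
  proof -
    have "P n g = c 0 (id_tensor (P (Suc m)) g)"
      unfolding n by (rule P_Suc')
    also have "P (Suc m) = (\<lambda>f. c 0 (id_tensor (P m) f))"
      by (intro ext) (simp only: P_Suc')
    finally show ?thesis by (simp add: id_tensor_comp)
  qed
  show ?case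
    by (simp only: P c_braid c_0_id_tensor2[OF braid_op_scale[OF braid_op_P[OF lessI]], symmetric])
next
  case (Suc i)
  then obtain m where n: "n = Suc m" and m: "Suc i < m"
    by (cases n) auto
  have "c (Suc (Suc i)) (P n f) = c 0 (c (Suc (Suc i)) (id_tensor (P m) f))"
    unfolding n P_Suc' c.simps(2) by (intro c_0_id_tensor2 c_scale)
  also have "\<dots> = c 0 (id_tensor (\<lambda>f. c (Suc i) (P m f)) f)"
    by (simp add: id_tensor_comp)
  also have "(\<lambda>f. c (Suc i) (P m f)) = (\<lambda>f. P m (c i f))"
    by (intro ext) (simp only: Suc.IH[OF m])
  also have "c 0 (id_tensor (\<lambda>f. P m (c i f)) f) = P n (c (Suc i) f)"
    unfolding n P_Suc' by (simp add: id_tensor_comp)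
  finally show ?case .
qed

text \<open>The innermost factor \<open>c (n - 1)\<close> needs \<open>n + 1\<close>
  letters.\<close>

lemma P_short: "length w \<le> n \<Longrightarrow> 0 < n \<Longrightarrow> P n f w = 0"
proof (cases n)
  case (Suc m)
  moreover assume "length w \<le> n"
  ultimately show ?thesis
    by (auto intro!: braid_op_vanish[OF braid_op_P[OF lessI]] c_short)
qed simp

text \<open>Extends \<open>c_P\<close> from generators to all operators: passing c_1 ... c_N shifts
  an operator by one position. \<open>0 < N\<close> matters since \<open>P 0\<close> is the
  identity, while \<open>id_tensor\<close> loses the empty word.\<close>

lemma braid_op_P_commute:
  "braid_op n F \<Longrightarrow> n \<le> N \<Longrightarrow> 0 < N \<Longrightarrow> id_tensor F (P N f) = P N (F f)"
proof (induction arbitrary: f rule: braid_op.induct)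
  case (trunc k n)
  show ?case
  proof
    fix w
    show "id_tensor (\<lambda>f w. if k \<le> length w then f w else 0) (P N f) w =
        P N (\<lambda>w. if k \<le> length w then f w else 0) w"
    proof (cases "length w \<le> N")
      case True
      then show ?thesis using trunc by (cases w) (auto simp: P_short)
    next
      case False
      then have "P N (\<lambda>w. if k \<le> length w then f w else 0) w = P N f w"
        using trunc by (intro braid_op_local[OF braid_op_P[OF lessI]]) auto
      then show ?thesis using trunc False by (cases w) auto
    qed
  qed
next
  case (gen i n)
  then show ?case using c_P[of i N f] by simp
next
  case (comp n F G)
  then show ?case by (simp flip: id_tensor_comp)
next
  case (add n F G)
  have "id_tensor (\<lambda>f w. F f w + G f w) (P N f) w = id_tensor F (P N f) w + id_tensor G (P N f) w"
    for w by (cases w) auto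
  then show ?case
    using add by (simp add: fun_eq_iff braid_op_add[OF braid_op_P[OF lessI]])
qed

text \<open>\<open>S\<^sub>n\<^sub>+\<^sub>1 = (I \<otimes> R\<^sub>n + c\<^sub>1 \<dots> c\<^sub>n) (S\<^sub>n \<otimes> I)\<close>: here \<open>S\<^sub>n \<otimes> I\<close> is \<open>S n\<close> itself, which acts on
  the first \<open>n\<close> letters of longer words.\<close>

lemma S_Suc_right: "\<exists>R. braid_op (Suc n) R \<and> (\<forall>f. S (Suc n) f = R (S n f))"
proof (induction n)
  case 0
  \<comment> \<open>The identity is no witness, because \<open>S (Suc 0)\<close> kills the empty
    word; \<open>S (Suc 0)\<close> itself is one, as \<open>S 0\<close> is the identity.\<close>
  show ?case using braid_op_S[of "Suc 0"] by (intro exI[of _ "S (Suc 0)"]) auto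
next
  case (Suc n)
  then obtain R where R: "braid_op (Suc n) R" and S: "\<And>f. S (Suc n) f = R (S n f)"
    by blast
  \<comment> \<open>Split \<open>T (Suc n)\<close> into \<open>T n\<close> and its last summand. The
    first part becomes I \<otimes> R after S_{n+1} by induction; in the second, S_{n+1} moves across
    c_1 ... c_{n+1}.\<close>
  have "S (Suc (Suc n)) f w = id_tensor R (S (Suc n) f) w + P (Suc n) (S (Suc n) f) w" for f w
  proof -
    have *: "id_tensor (S (Suc n)) = (\<lambda>f. id_tensor R (id_tensor (S n) f))"
      by (intro ext) (simp only: ext[OF S] id_tensor_comp)
    have "S (Suc (Suc n)) f = (\<lambda>w. id_tensor (S (Suc n)) (T n f) w
        + id_tensor (S (Suc n)) (P (Suc n) f) w)"
      unfolding S.simps(2)[of "Suc n"] T_Suc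
      by (rule braid_op_add[OF braid_op_id_tensor[OF braid_op_S]])
    also have "id_tensor (S (Suc n)) (T n f) = id_tensor R (S (Suc n) f)"
      unfolding * by simp
    also have "id_tensor (S (Suc n)) (P (Suc n) f) = P (Suc n) (S (Suc n) f)"
      by (rule braid_op_P_commute[OF braid_op_S]) auto
    finally show ?thesis by simp
  qed
  moreover have "braid_op (Suc (Suc n)) (\<lambda>f w. id_tensor R f w + P (Suc n) f w)"
    by (intro braid_op.add braid_op_id_tensor R braid_op_P) simp
  ultimately show ?case
    by (intro exI[of _ "\<lambda>f w. id_tensor R f w + P (Suc n) f w"]) auto
qed

text \<open>All summands but the first begin with c_1, which is factored out.\<close>

lemma T_Suc': "T (Suc n) f = (\<lambda>w. f w + c 0 (id_tensor (T n) f) w)"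
proof (induction n)
  case 0
  have "T (Suc 0) f = (\<lambda>w. f w + P (Suc 0) f w)"
    by (simp add: T_Suc T_0)
  then show ?case unfolding P_Suc' by (simp add: T_0)
next
  case (Suc n)
  have "id_tensor (T (Suc n)) f = (\<lambda>w. id_tensor (T n) f w + id_tensor (P (Suc n)) f w)"
  proof
    show "id_tensor (T (Suc n)) f w = id_tensor (T n) f w + id_tensor (P (Suc n)) f w" for w
      by (cases w) (auto simp: T_Suc)
  qed
  then have "c 0 (id_tensor (T (Suc n)) f) =
      (\<lambda>w. c 0 (id_tensor (T n) f) w + P (Suc (Suc n)) f w)"
    unfolding P_Suc' by (simp add: c_add)
  moreover have "T (Suc (Suc n)) f = (\<lambda>w. T (Suc n) f w + P (Suc (Suc n)) f w)"
    by (simp only: T_Suc[of "Suc n"])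
  ultimately show ?case by (simp only: Suc add.assoc)
qed

text \<open>The left factors satisfy L_{n+1} = I + (I \<otimes> L_n) c_1: expand by
  \<open>T_Suc'\<close> and let c_1 commute with I \<otimes> I \<otimes> S_n.\<close>

lemma S_Suc_left: "\<exists>L. braid_op (Suc n) L \<and> (\<forall>f. S (Suc n) f = L (id_tensor (S n) f))"
proof (induction n)
  case 0
  show ?case by (intro exI[of _ "\<lambda>f. f"]) (simp add: braid_op_ident T_0)
next
  case (Suc n)
  then obtain L where L: "braid_op (Suc n) L" and S: "\<And>f. S (Suc n) f = L (id_tensor (S n) f)"
    by blast
  have "S (Suc (Suc n)) f =
    (\<lambda>w. id_tensor (S (Suc n)) f w + id_tensor L (c 0 (id_tensor (S (Suc n)) f)) w)" for f
  proof -
    have *: "id_tensor (S (Suc n)) = (\<lambda>f. id_tensor L (id_tensor (id_tensor (S n)) f))"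
      by (intro ext) (simp only: ext[OF S] id_tensor_comp)
    have "id_tensor (S (Suc n)) (c 0 (id_tensor (T n) f)) =
        id_tensor L (c 0 (id_tensor (id_tensor (S n)) (id_tensor (T n) f)))"
      unfolding * by (simp only: c_0_id_tensor2[OF braid_op_scale[OF braid_op_S]])
    also have "id_tensor (id_tensor (S n)) (id_tensor (T n) f) = id_tensor (S (Suc n)) f"
      by (simp add: id_tensor_comp)
    finally show ?thesis
      unfolding S.simps(2)[of "Suc n"] T_Suc'
      by (subst braid_op_add[OF braid_op_id_tensor[OF braid_op_S]]) simp
  qed
  moreover have "braid_op (Suc (Suc n)) (\<lambda>f w. f w + id_tensor L (c 0 f) w)"
    by (intro braid_op.add braid_op_ident braid_op.comp[OF braid_op_id_tensor[OF L]] braid_op.gen)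
      simp
  ultimately show ?case
    by (intro exI[of _ "\<lambda>f w. f w + id_tensor L (c 0 f) w"]) blast
qed

lemma S_add_right: "\<exists>R. braid_op (n + m) R \<and> (\<forall>f. S (n + m) f = R (S n f))"
proof (induction m)
  case 0
  show ?case by (intro exI[of _ "\<lambda>f. f"]) (simp add: braid_op_ident)
next
  case (Suc m)
  then obtain R where R: "braid_op (n + m) R" "\<And>f. S (n + m) f = R (S n f)"
    by blast
  obtain R' where R': "braid_op (Suc (n + m)) R'" "\<And>f. S (Suc (n + m)) f = R' (S (n + m) f)"
    using S_Suc_right by blast
  have "braid_op (n + Suc m) (\<lambda>f. R' (R f))"
    using braid_op.comp[OF R'(1) braid_op_mono[OF R(1)]] by simp
  moreover have "S (n + Suc m) f = R' (R (S n f))" for f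
    using R(2) R'(2) by (simp only: add_Suc_right)
  ultimately show ?case by blast
qed

lemma S_add_left:
  "\<exists>L. braid_op (m + n) L \<and> (\<forall>f. S (m + n) f = L ((id_tensor ^^ m) (S n) f))"
proof (induction m)
  case 0
  show ?case by (intro exI[of _ "\<lambda>f. f"]) (simp add: braid_op_ident)
next
  case (Suc m)
  then obtain L where L: "braid_op (m + n) L"
    "\<And>f. S (m + n) f = L ((id_tensor ^^ m) (S n) f)"
    by blast
  obtain L' where L': "braid_op (Suc (m + n)) L'"
    "\<And>f. S (Suc (m + n)) f = L' (id_tensor (S (m + n)) f)"
    using S_Suc_left by blast
  have "id_tensor (S (m + n)) f = id_tensor L ((id_tensor ^^ Suc m) (S n) f)" for f
  proof -
    have "S (m + n) = (\<lambda>f. L ((id_tensor ^^ m) (S n) f))"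
      by (intro ext) (simp only: L)
    then show ?thesis by (simp add: id_tensor_comp)
  qed
  moreover have "braid_op (Suc m + n) (\<lambda>f. L' (id_tensor L f))"
    using braid_op.comp[OF L'(1) braid_op_id_tensor[OF L(1)]] by simp
  ultimately show ?case
    using L'(2) by (intro exI[of _ "\<lambda>f. L' (id_tensor L f)"]) simp
qed

section \<open>Kernels of the symmetrizers under multiplication\<close>

lemma id_tensor_pow:
  "m \<le> length w \<Longrightarrow> (id_tensor ^^ m) F f w = F (\<lambda>v. f (take m w @ v)) (drop m w)"
proof (induction m arbitrary: f w)
  case (Suc m)
  then show ?case by (cases w) auto
qed simp

text \<open>For a product cut at the fixed position \<open>i\<close>, the factor I \<otimes> S_n of
  the symmetrizer acts on \<open>g\<close> alone and sees \<open>f (take i w)\<close> as a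
  scalar.\<close>

lemma S_vanish_left:
  assumes "i \<le> length w" and "\<And>v. S (length v) g v = 0"
  shows "S (length w) (\<lambda>w. f (take i w) * g (drop i w)) w = 0"
proof -
  let ?n = "length w - i"
  let ?h = "\<lambda>w. f (take i w) * g (drop i w)"
  obtain L where L: "braid_op (i + ?n) L" "\<And>f. S (i + ?n) f = L ((id_tensor ^^ i) (S ?n) f)"
    using S_add_left by blast
  have "(id_tensor ^^ i) (S ?n) ?h u = 0" if "length u = length w" for u
  proof -
    have "(id_tensor ^^ i) (S ?n) ?h u = S ?n (\<lambda>v. f (take i u) * g v) (drop i u)"
      using that assms(1) by (simp add: id_tensor_pow min_absorb2)
    also have "\<dots> = f (take i u) * S ?n g (drop i u)"
      by (simp only: braid_op_scale[OF braid_op_S])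
    also have "S ?n g (drop i u) = 0"
      using assms(2)[of "drop i u"] that by simp
    finally show ?thesis by simp
  qed
  then show ?thesis
    using braid_op_vanish[OF L(1)] L(2) assms(1) by simp
qed

text \<open>Mirror image: the factor S_i \<otimes> I acts on the first \<open>i\<close> letters, and
  the value of \<open>g\<close> on the rest is a scalar.\<close>

lemma S_vanish_right:
  assumes "i \<le> length w" and "\<And>v. S (length v) f v = 0"
  shows "S (length w) (\<lambda>w. f (take i w) * g (drop i w)) w = 0"
proof -
  let ?n = "length w - i"
  let ?h = "\<lambda>w. f (take i w) * g (drop i w)"
  obtain R where R: "braid_op (i + ?n) R" "\<And>f. S (i + ?n) f = R (S i f)"
    using S_add_right by blast
  have "S i ?h u = 0" if "length u = length w" for u
  proof -
    have "S i ?h u = S i ?h (take i u @ drop i u)"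
      by simp
    also have "\<dots> = S i (\<lambda>v. ?h (v @ drop i u)) (take i u)"
      using that assms(1) by (intro braid_op_append[OF braid_op_S]) auto
    also have "\<dots> = S i (\<lambda>v. g (drop i u) * f v) (take i u)"
      using that assms(1) by (intro braid_op_local[OF braid_op_S]) (auto simp: min_absorb2)
    also have "\<dots> = g (drop i u) * S i f (take i u)"
      by (simp only: braid_op_scale[OF braid_op_S])
    also have "S i f (take i u) = 0"
      using assms(2)[of "take i u"] that assms(1) by (simp add: min_absorb2)
    finally show ?thesis by simp
  qed
  then show ?thesis
    using braid_op_vanish[OF R(1)] R(2) assms(1) by simp
qed

lemma braid_op_sum:
  assumes "braid_op n F" and "finite A"
  shows "F (\<lambda>w. \<Sum>i\<in>A. f i w) = (\<lambda>w. \<Sum>i\<in>A. F (f i) w)"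
  using assms(2)
proof (induction A rule: finite_induct)
  case (insert x A)
  then show ?case
    using braid_op_add[OF assms(1), of "f x" "\<lambda>w. \<Sum>i\<in>A. f i w"] by simp
qed (simp add: braid_op_zero[OF assms(1)])

end

section \<open>The Nichols algebra of a rack with constant cocycle\<close>

text \<open>Outside \<open>X\<close> the operation is extended in such a way that it is self-distributive on the whole
  type.\<close>

definition left_div :: "'x set \<Rightarrow> ('x \<Rightarrow> 'x \<Rightarrow> 'x) \<Rightarrow> 'x \<Rightarrow> 'x \<Rightarrow> 'x" where
  "left_div X tri x y = (if x \<in> X \<and> y \<in> X then inv_into X (tri x) y else y)"

context rack
begin

lemma tri_closed [simp]: "x \<in> X \<Longrightarrow> y \<in> X \<Longrightarrow> x \<triangleright> y \<in> X"
  using bij_tri bij_betwE by blast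

lemma left_div_in_iff: "x \<in> X \<Longrightarrow> left_div X (\<triangleright>) x y \<in> X \<longleftrightarrow> y \<in> X"
  using bij_tri[of x] by (auto simp: left_div_def bij_betw_def inv_into_into)

lemma left_div_tri [simp]: "x \<in> X \<Longrightarrow> y \<in> X \<Longrightarrow> left_div X (\<triangleright>) x (x \<triangleright> y) = y"
  using bij_tri[of x] by (simp add: left_div_def bij_betw_def)

lemma tri_left_div [simp]: "x \<in> X \<Longrightarrow> y \<in> X \<Longrightarrow> x \<triangleright> left_div X (\<triangleright>) x y = y"
  using bij_tri[of x] by (simp add: left_div_def bij_betw_def f_inv_into_f)

lemma left_div_outside: "x \<notin> X \<or> y \<notin> X \<Longrightarrow> left_div X (\<triangleright>) x y = y"
  by (auto simp: left_div_def)

text \<open>Inside \<open>X\<close>, self-distributivity shows that \<open>x\<close> acting on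
  \<open>?a \<triangleright> ?u\<close> gives \<open>z\<close>. Otherwise some division is trivial,
  and dividing by an element of \<open>X\<close> preserves both \<open>X\<close> and its
  complement.\<close>

lemma left_div_distrib:
  "left_div X (\<triangleright>) x (left_div X (\<triangleright>) y z) =
    left_div X (\<triangleright>) (left_div X (\<triangleright>) x y) (left_div X (\<triangleright>) x z)"
proof (cases "x \<in> X \<and> y \<in> X \<and> z \<in> X")
  case True
  let ?a = "left_div X (\<triangleright>) x y" and ?u = "left_div X (\<triangleright>) x (left_div X (\<triangleright>) y z)"
  have [simp]: "?a \<in> X" "?u \<in> X" "x \<triangleright> ?u = left_div X (\<triangleright>) y z"
    using True by (simp_all add: left_div_in_iff)
  have "x \<triangleright> (?a \<triangleright> ?u) = y \<triangleright> (x \<triangleright> ?u)"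
    using True self_distrib[of x ?a ?u] by simp
  also have "\<dots> = z"
    using True by simp
  finally have "left_div X (\<triangleright>) x z = ?a \<triangleright> ?u"
    using True left_div_tri[of x "?a \<triangleright> ?u"] by simp
  then show ?thesis by simp
next
  case False
  then show ?thesis
    by (cases "x \<in> X"; cases "y \<in> X"; cases "z \<in> X")
      (simp_all add: left_div_outside left_div_in_iff)
qed

end

locale rack_constant_cocycle = rack +
  fixes q :: "'a \<Rightarrow> 'a \<Rightarrow> 'k::field" and \<kappa> :: 'k
  assumes q_eq: "x \<in> X \<Longrightarrow> y \<in> X \<Longrightarrow> q x y = \<kappa>"
begin

sublocale constant_braiding "left_div X (\<triangleright>)" \<kappa>
  by unfold_locales (rule left_div_distrib)

section \<open>Comparison with the operators of the definition\<close>

definition supported :: "nat \<Rightarrow> ('a list \<Rightarrow> 'k) \<Rightarrow> bool" where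
  "supported n f \<longleftrightarrow> (\<forall>w. f w \<noteq> 0 \<longrightarrow> set w \<subseteq> X \<and> length w = n)"

text \<open>Inverse of \<open>braid_word\<close> on words over \<open>X\<close>; the index is
  zero-based, so it is paired with \<open>braid_word (\<triangleright>) (Suc i)\<close>.\<close>

definition unbraid :: "nat \<Rightarrow> 'a list \<Rightarrow> 'a list" where
  "unbraid i w = w[i := w ! Suc i, Suc i := left_div X (\<triangleright>) (w ! Suc i) (w ! i)]"

lemma c_unbraid: "Suc i < length w \<Longrightarrow> c i f w = \<kappa> * f (unbraid i w)"
proof (induction i arbitrary: f w)
  case 0
  then show ?case by (cases w rule: word_cases) (auto simp: unbraid_def)
next
  case (Suc i)
  then show ?case by (cases w) (auto simp: unbraid_def)
qed

lemma braid_word_eq_iff: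
  assumes "set u \<subseteq> X" and "length u = length w" and "Suc i < length w"
  shows "braid_word (\<triangleright>) (Suc i) u = w \<longleftrightarrow> u = unbraid i w"
proof
  have X: "u ! i \<in> X" "u ! Suc i \<in> X"
    using assms by (auto simp: subset_iff)
  assume w: "braid_word (\<triangleright>) (Suc i) u = w"
  show "u = unbraid i w"
    unfolding w[symmetric] using X assms
    by (intro nth_equalityI) (auto simp: unbraid_def braid_word_def nth_list_update)
next
  assume u: "u = unbraid i w"
  have "u ! i \<in> X" "u ! Suc i \<in> X"
    using assms by (auto simp: subset_iff)
  \<comment> \<open>\<open>left_div_in_iff\<close> is read backwards here: the letters of
    \<open>w\<close> are in \<open>X\<close> because those of \<open>unbraid i w\<close>
    are.\<close>
  then have "w ! Suc i \<in> X" "w ! i \<in> X"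
    using assms u by (auto simp: unbraid_def nth_list_update left_div_in_iff)
  then show "braid_word (\<triangleright>) (Suc i) u = w"
    using assms u by (intro nth_equalityI) (auto simp: unbraid_def braid_word_def nth_list_update)
qed

lemma set_braid_word:
  assumes "set u \<subseteq> X" and "Suc i < length u"
  shows "set (braid_word (\<triangleright>) (Suc i) u) \<subseteq> X"
proof -
  have "u ! i \<in> X" "u ! Suc i \<in> X"
    using assms by (auto simp: subset_iff)
  then show ?thesis
    unfolding braid_word_def using assms by (intro set_update_subsetI) simp_all
qed

lemma length_braid_word [simp]: "length (braid_word (\<triangleright>) i u) = length u"
  by (simp add: braid_word_def)

lemma supported_c:
  assumes "supported n f" and "Suc i < n"
  shows "supported n (c i f)"
  unfolding supported_def
proof (intro allI impI)
  fix w assume w: "c i f w \<noteq> 0"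
  have len: "length w = n"
  proof (rule ccontr)
    assume "length w \<noteq> n"
    then have "c i f w = 0"
      using assms by (intro braid_op_vanish[OF braid_op.gen[OF lessI]]) (auto simp: supported_def)
    with w show False by simp
  qed
  with w assms have "f (unbraid i w) \<noteq> 0"
    by (auto simp: c_unbraid)
  then have "set (unbraid i w) \<subseteq> X" "length (unbraid i w) = n"
    using assms by (auto simp: supported_def)
  then have "set w \<subseteq> X"
    using set_braid_word[of "unbraid i w" i] braid_word_eq_iff[of "unbraid i w" w i] assms len
    by auto
  with len show "set w \<subseteq> X \<and> length w = n" by simp
qed

text \<open>The sum in \<open>braid_at\<close> has at most one term, the preimage
  \<open>unbraid i w\<close>.\<close>

lemma braid_at_eq_c:
  assumes "supported n f" and "Suc i < n"
  shows "braid_at (\<triangleright>) q (Suc i) f = c i f"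
proof
  fix w
  show "braid_at (\<triangleright>) q (Suc i) f w = c i f w"
  proof (cases "length w = n")
    case True
    have "{u. f u \<noteq> 0 \<and> braid_word (\<triangleright>) (Suc i) u = w} =
        {u. f u \<noteq> 0 \<and> u = unbraid i w}"
      using assms True
      by (intro Collect_cong conj_cong refl braid_word_eq_iff) (auto simp: supported_def)
    also have "\<dots> = (if f (unbraid i w) \<noteq> 0 then {unbraid i w} else {})"
      by auto
    finally have "braid_at (\<triangleright>) q (Suc i) f w =
        f (unbraid i w) * q (unbraid i w ! i) (unbraid i w ! Suc i)"
      by (simp add: braid_at_def)
    also have "\<dots> = \<kappa> * f (unbraid i w)"
    \<comment> \<open>\<open>q\<close> is constant only on \<open>X\<close>; a nonzero coefficient
      guarantees letters from \<open>X\<close>.\<close>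
    proof (cases "f (unbraid i w) = 0")
      case False
      then have "unbraid i w ! i \<in> X" "unbraid i w ! Suc i \<in> X"
        using assms by (auto simp: supported_def subset_iff)
      then show ?thesis by (simp add: q_eq)
    qed simp
    finally show ?thesis using True assms by (simp add: c_unbraid)
  next
    case False
    have "{u. f u \<noteq> 0 \<and> braid_word (\<triangleright>) (Suc i) u = w} = {}"
      using assms False by (auto simp: supported_def)
    then have "braid_at (\<triangleright>) q (Suc i) f w = 0"
      unfolding braid_at_def by (simp only: sum.empty)
    moreover have "c i f w = 0"
      using supported_c[OF assms] False by (auto simp: supported_def)
    ultimately show ?thesis by simp
  qed
qed

text \<open>The support claim is carried along because each replacement of \<open>braid_at\<close>
  by \<open>c\<close> requires it.\<close>

lemma foldr_braid_at:
  assumes "supported n f" and "k < n"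
  shows "foldr (braid_at (\<triangleright>) q) [1..<Suc k] f = P k f \<and> supported n (P k f)"
  using assms
proof (induction k arbitrary: f)
  case (Suc k)
  then show ?case by (simp add: braid_at_eq_c supported_c)
qed simp

lemma supported_T:
  assumes "supported n f" and "k < n"
  shows "supported n (T k f)"
  unfolding supported_def
proof (intro allI impI)
  fix w assume "T k f w \<noteq> 0"
  then obtain j where j: "j \<le> k" "P j f w \<noteq> 0"
    unfolding T_def by (meson atMost_iff sum.neutral)
  then have "supported n (P j f)"
    using foldr_braid_at[of n f j] assms le_less_trans by blast
  with j(2) show "set w \<subseteq> X \<and> length w = n"
    unfolding supported_def by blast
qed

lemma quantum_sym_eq_S: "supported n f \<Longrightarrow> quantum_sym (\<triangleright>) q n f = S n f"
proof (induction n arbitrary: f)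
  case (Suc n)
  have "(\<lambda>w. \<Sum>k\<le>n. foldr (braid_at (\<triangleright>) q) [1..<Suc k] f w) = T n f"
    unfolding T_def using foldr_braid_at[OF Suc.prems]
    by (intro ext sum.cong) (simp_all del: upt_Suc)
  moreover have "id_tensor (quantum_sym (\<triangleright>) q n) (T n f) w = id_tensor (S n) (T n f) w" for w
  proof (cases w)
    case (Cons x v)
    have "supported n (\<lambda>u. T n f (x # u))"
      unfolding supported_def
      using supported_T[OF Suc.prems lessI, unfolded supported_def, rule_format] by fastforce
    with Cons show ?thesis by (simp add: Suc.IH)
  qed simp
  ultimately show ?case by (simp add: fun_eq_iff del: upt_Suc)
qed simp

text \<open>By locality the value of \<open>S n\<close> at a word of length \<open>n\<close> depends
  only on the part of degree \<open>n\<close>, so the conditions on all homogeneous parts merge into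
  one.\<close>

lemma nichols_ideal_iff:
  "f \<in> nichols_ideal X (\<triangleright>) q \<longleftrightarrow>
    f \<in> tensor_carrier X \<and> (\<forall>w. S (length w) f w = 0)"
proof -
  have "(\<forall>n. quantum_sym (\<triangleright>) q n (homogeneous_part n f) = (\<lambda>w. 0)) \<longleftrightarrow>
      (\<forall>w. S (length w) f w = 0)" if "f \<in> tensor_carrier X"
  proof -
    have "quantum_sym (\<triangleright>) q n (homogeneous_part n f) w =
        (if length w = n then S (length w) f w else 0)" for n w
    proof -
      have "supported n (homogeneous_part n f)"
        using that by (auto simp: supported_def homogeneous_part_def tensor_carrier_def)
      then have "quantum_sym (\<triangleright>) q n (homogeneous_part n f) w = S n (homogeneous_part n f) w"
        by (simp add: quantum_sym_eq_S)
      also have "\<dots> = (if length w = n then S (length w) f w else 0)"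
        by (auto intro!: braid_op_local[OF braid_op_S] braid_op_vanish[OF braid_op_S]
            simp: homogeneous_part_def)
      finally show ?thesis .
    qed
    then show ?thesis by (auto simp: fun_eq_iff)
  qed
  then show ?thesis by (auto simp: nichols_ideal_def)
qed

end

section \<open>The tensor algebra and its quotient\<close>

definition conv :: "('x list \<Rightarrow> 'k::field) \<Rightarrow> ('x list \<Rightarrow> 'k) \<Rightarrow> 'x list \<Rightarrow> 'k" where
  "conv f g = (\<lambda>w. \<Sum>i\<le>length w. f (take i w) * g (drop i w))"

text \<open>Splitting off the first letter replaces the sum over cut positions by a recursion, so
  that associativity becomes a list induction.\<close>

lemma conv_simps [simp]:
  "conv f g [] = f [] * g []"
  "conv f g (x # w) = f [] * g (x # w) + conv (\<lambda>u. f (x # u)) g w"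
  unfolding conv_def by (simp, simp add: sum.atMost_Suc_shift del: sum.atMost_Suc)

lemma conv_add_left: "conv (\<lambda>w. f w + g w) h = (\<lambda>w. conv f h w + conv g h w)"
  by (simp add: conv_def fun_eq_iff algebra_simps sum.distrib)

lemma conv_add_right: "conv f (\<lambda>w. g w + h w) = (\<lambda>w. conv f g w + conv f h w)"
  by (simp add: conv_def fun_eq_iff algebra_simps sum.distrib)

lemma conv_scale_left: "conv (\<lambda>w. a * f w) g = (\<lambda>w. a * conv f g w)"
  by (simp add: conv_def fun_eq_iff algebra_simps sum_distrib_left)

lemma conv_zero_left: "conv (\<lambda>w. 0) g = (\<lambda>w. 0)"
  by (simp add: conv_def)

lemma conv_assoc: "conv (conv f g) h = conv f (conv g h)"
proof
  fix w
  show "conv (conv f g) h w = conv f (conv g h) w"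
  proof (induction w arbitrary: f g h)
    case (Cons x w)
    then show ?case by (simp add: conv_add_left conv_scale_left algebra_simps)
  qed simp
qed

definition delta :: "'x list \<Rightarrow> 'x list \<Rightarrow> 'k::field" where
  "delta u = (\<lambda>w. if w = u then 1 else 0)"

lemma delta_neq_0_iff [simp]: "(delta u w :: 'k::field) \<noteq> 0 \<longleftrightarrow> w = u"
  by (simp add: delta_def)

lemma conv_delta_Nil_left: "conv (delta []) f = f"
proof
  show "conv (delta []) f w = f w" for w
    by (cases w) (auto simp: delta_def conv_zero_left)
qed

lemma conv_delta_Nil_right: "conv f (delta []) = f"
proof
  show "conv f (delta []) w = f w" for w
    by (induction w arbitrary: f) (auto simp: delta_def)
qed

lemma conv_delta_Cons: "conv (delta [x]) (delta u) = (delta (x # u) :: _ \<Rightarrow> 'k::field)"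
proof
  fix w
  show "conv (delta [x]) (delta u) w = (delta (x # u) w :: 'k)"
  proof (cases w)
    case (Cons y v)
    have "(\<lambda>u. delta [x] (y # u)) = (if x = y then delta [] else (\<lambda>w. 0 :: 'k))"
      by (auto simp: delta_def fun_eq_iff)
    with Cons show ?thesis
      by (auto simp: conv_delta_Nil_left conv_zero_left) (auto simp: delta_def)
  qed (simp add: delta_def)
qed

lemma tensor_algebra_simps [simp]:
  "carrier (tensor_algebra X) = tensor_carrier X"
  "f \<otimes>\<^bsub>tensor_algebra X\<^esub> g = conv f g"
  "\<one>\<^bsub>tensor_algebra X\<^esub> = delta []"
  "\<zero>\<^bsub>tensor_algebra X\<^esub> = (\<lambda>w. 0)"
  "f \<oplus>\<^bsub>tensor_algebra X\<^esub> g = (\<lambda>w. f w + g w)"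
  "a \<odot>\<^bsub>tensor_algebra X\<^esub> f = (\<lambda>w. a * f w)"
  "acomp (tensor_algebra X) n = {f \<in> tensor_carrier X. \<forall>w. f w \<noteq> 0 \<longrightarrow> length w = n}"
  by (auto simp: tensor_algebra_def conv_def delta_def)

lemma tensor_carrier_zero [simp]: "(\<lambda>w. 0) \<in> tensor_carrier X"
  by (simp add: tensor_carrier_def)

lemma tensor_carrier_add [simp]:
  assumes "f \<in> tensor_carrier X" "g \<in> tensor_carrier X"
  shows "(\<lambda>w. f w + g w) \<in> tensor_carrier X"
proof -
  have "{w. f w + g w \<noteq> 0} \<subseteq> {w. f w \<noteq> 0} \<union> {w. g w \<noteq> 0}"
    by auto
  with assms show ?thesis
    unfolding tensor_carrier_def by (auto intro: finite_subset)
qed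

lemma tensor_carrier_scale [simp]:
  assumes "f \<in> tensor_carrier X"
  shows "(\<lambda>w. a * f w) \<in> tensor_carrier X"
proof -
  have "{w. a * f w \<noteq> 0} \<subseteq> {w. f w \<noteq> 0}"
    by auto
  with assms show ?thesis
    unfolding tensor_carrier_def by (auto intro: finite_subset)
qed

lemma tensor_carrier_delta [simp]: "set u \<subseteq> X \<Longrightarrow> delta u \<in> tensor_carrier X"
  by (auto simp: tensor_carrier_def delta_def)

lemma conv_nonzero: "conv f g w \<noteq> 0 \<Longrightarrow> \<exists>u v. w = u @ v \<and> f u \<noteq> 0 \<and> g v \<noteq> 0"
  unfolding conv_def
  by (metis (no_types, lifting) append_take_drop_id mult_eq_0_iff sum.not_neutral_contains_not_neutral)

lemma tensor_carrier_conv [simp]: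
  assumes "f \<in> tensor_carrier X" "g \<in> tensor_carrier X"
  shows "conv f g \<in> tensor_carrier X"
proof -
  have "{w. conv f g w \<noteq> 0} \<subseteq> (\<lambda>(u, v). u @ v) ` ({w. f w \<noteq> 0} \<times> {w. g w \<noteq> 0})"
    by (auto dest!: conv_nonzero)
  moreover have "finite \<dots>"
    using assms by (auto simp: tensor_carrier_def)
  ultimately have "finite {w. conv f g w \<noteq> 0}"
    by (rule finite_subset)
  moreover have "set w \<subseteq> X" if "conv f g w \<noteq> 0" for w
    using conv_nonzero[OF that] assms by (auto simp: tensor_carrier_def subset_iff)
  ultimately show ?thesis
    unfolding tensor_carrier_def by blast
qed

lemma ring_tensor_algebra: "ring (tensor_algebra X)"
proof (rule ringI)
  show "abelian_group (tensor_algebra X)"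
  proof (rule abelian_groupI)
    show "\<exists>g\<in>carrier (tensor_algebra X). g \<oplus>\<^bsub>tensor_algebra X\<^esub> f = \<zero>\<^bsub>tensor_algebra X\<^esub>"
      if "f \<in> carrier (tensor_algebra X)" for f
      using that tensor_carrier_scale[of f X "-1"] by (intro bexI[of _ "\<lambda>w. - 1 * f w"]) simp_all
  qed (auto simp: algebra_simps)
  show "monoid (tensor_algebra X)"
    by (rule monoidI) (auto simp: conv_assoc conv_delta_Nil_left conv_delta_Nil_right)
qed (auto simp: conv_add_left conv_add_right)

section \<open>The Nichols ideal and the quotient by it\<close>

context rack_constant_cocycle
begin

abbreviation "I \<equiv> nichols_ideal X (\<triangleright>) q"

lemma nichols_ideal_scale: "f \<in> I \<Longrightarrow> (\<lambda>w. a * f w) \<in> I"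
  by (auto simp: nichols_ideal_iff braid_op_scale[OF braid_op_S])

lemma nichols_ideal_add: "f \<in> I \<Longrightarrow> g \<in> I \<Longrightarrow> (\<lambda>w. f w + g w) \<in> I"
  by (auto simp: nichols_ideal_iff braid_op_add[OF braid_op_S])

lemma S_conv:
  "S (length w) (conv f g) w = (\<Sum>i\<le>length w. S (length w) (\<lambda>u. f (take i u) * g (drop i u)) w)"
proof -
  have "S (length w) (conv f g) w =
      S (length w) (\<lambda>u. \<Sum>i\<le>length w. f (take i u) * g (drop i u)) w"
    \<comment> \<open>Only words of length \<open>length w\<close> matter, so the summation bound
      becomes constant and linearity applies.\<close>
    by (rule braid_op_local[OF braid_op_S]) (simp add: conv_def)
  then show ?thesis by (simp add: braid_op_sum[OF braid_op_S])
qed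

lemma ideal_nichols_ideal: "ideal I (tensor_algebra X)"
proof (rule idealI)
  interpret ring "tensor_algebra X" by (rule ring_tensor_algebra)
  show "subgroup I (add_monoid (tensor_algebra X))"
  proof (rule add.subgroupI)
    show "I \<noteq> {}"
      using nichols_ideal_iff[of "\<lambda>w. 0"] by (auto simp: braid_op_zero[OF braid_op_S])
    show "\<ominus>\<^bsub>tensor_algebra X\<^esub> f \<in> I" if "f \<in> I" for f
    proof -
      have "\<ominus>\<^bsub>tensor_algebra X\<^esub> f = (\<lambda>w. - 1 * f w)"
        using that tensor_carrier_scale[of f X "-1"]
        by (intro minus_equality) (auto simp: nichols_ideal_iff)
      then show ?thesis using nichols_ideal_scale[OF that, of "-1"] by simp
    qed
  qed (auto simp: nichols_ideal_add, auto simp: nichols_ideal_iff)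
  fix f g :: "'a list \<Rightarrow> 'k" assume "f \<in> I" "g \<in> carrier (tensor_algebra X)"
  then have f: "f \<in> tensor_carrier X" "\<And>w. S (length w) f w = 0" and g: "g \<in> tensor_carrier X"
    by (auto simp: nichols_ideal_iff)
  show "g \<otimes>\<^bsub>tensor_algebra X\<^esub> f \<in> I"
    using f(1) g by (simp add: nichols_ideal_iff S_conv S_vanish_left f(2))
  show "f \<otimes>\<^bsub>tensor_algebra X\<^esub> g \<in> I"
    using f(1) g by (simp add: nichols_ideal_iff S_conv S_vanish_right f(2))
qed (rule ring_tensor_algebra)

abbreviation cl :: "('a list \<Rightarrow> 'k) \<Rightarrow> ('a list \<Rightarrow> 'k) set" where
  "cl f \<equiv> I +>\<^bsub>tensor_algebra X\<^esub> f"

abbreviation "\<B> \<equiv> nichols_algebra X (\<triangleright>) q"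

lemma
  shows carrier_nichols: "carrier \<B> = cl ` tensor_carrier X"
    and acomp_nichols: "acomp \<B> n = cl ` acomp (tensor_algebra X) n"
    and one_nichols: "\<one>\<^bsub>\<B>\<^esub> = cl (delta [])"
  by (auto simp: nichols_algebra_def quotient_graded_algebra_def ring.defs FactRing_def
      A_RCOSETS_def')

lemma mult_nichols:
  assumes "f \<in> tensor_carrier X" "g \<in> tensor_carrier X"
  shows "cl f \<otimes>\<^bsub>\<B>\<^esub> cl g = cl (conv f g)"
  using ideal.rcoset_mult_add[OF ideal_nichols_ideal, of f g] assms
  by (simp add: nichols_algebra_def quotient_graded_algebra_def ring.defs FactRing_def)

lemma add_nichols:
  assumes "f \<in> tensor_carrier X" "g \<in> tensor_carrier X"
  shows "cl f \<oplus>\<^bsub>\<B>\<^esub> cl g = cl (\<lambda>w. f w + g w)"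
  using ideal.a_rcos_sum[OF ideal_nichols_ideal, of f g] assms
  by (simp add: nichols_algebra_def quotient_graded_algebra_def ring.defs FactRing_def)

lemma cl_eqI:
  assumes "f \<in> tensor_carrier X" "h \<in> I"
  shows "cl (\<lambda>w. h w + f w) = cl f"
proof -
  interpret ideal I "tensor_algebra X" by (rule ideal_nichols_ideal)
  have "(\<lambda>w. h w + f w) \<in> cl f"
    unfolding a_r_coset_def' using assms(2) by auto
  then show ?thesis
    using a_repr_independence'[of "\<lambda>w. h w + f w" f] assms by simp
qed

text \<open>The union in the definition runs over all representatives; each yields the same coset
  because the ideal is closed under scaling.\<close>

lemma smult_nichols:
  assumes "f \<in> tensor_carrier X"
  shows "a \<odot>\<^bsub>\<B>\<^esub> cl f = cl (\<lambda>w. a * f w)"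
proof -
  interpret ideal I "tensor_algebra X" by (rule ideal_nichols_ideal)
  have "cl (\<lambda>w. a * g w) = cl (\<lambda>w. a * f w)" if g_in: "g \<in> cl f" for g
  proof -
    obtain h where "h \<in> I" and g: "g = (\<lambda>w. h w + f w)"
      using g_in unfolding a_r_coset_def' by auto
    then show ?thesis
      using cl_eqI[of "\<lambda>w. a * f w" "\<lambda>w. a * h w"] assms nichols_ideal_scale
      by (simp add: algebra_simps)
  qed
  moreover have "f \<in> cl f"
    using a_rcos_self assms by simp
  ultimately have "(\<Union>x\<in>cl f. cl (\<lambda>w. a * x w)) = cl (\<lambda>w. a * f w)"
    by blast
  then show ?thesis
    by (simp add: nichols_algebra_def quotient_graded_algebra_def ring.defs)
qed

end

text \<open>Scalars and letters generate the tensor algebra. The induction is on a finite set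
  containing the support, removing one word at a time.\<close>

lemma tensor_induct [consumes 1, case_names scalar letter add mult]:
  fixes f :: "'x list \<Rightarrow> 'k::field"
  assumes f: "f \<in> tensor_carrier X"
    and scalar: "\<And>a. Q (\<lambda>w. a * delta [] w)"
    and letter: "\<And>x. x \<in> X \<Longrightarrow> Q (delta [x])"
    and add: "\<And>f g. f \<in> tensor_carrier X \<Longrightarrow> g \<in> tensor_carrier X \<Longrightarrow> Q f \<Longrightarrow> Q g \<Longrightarrow>
      Q (\<lambda>w. f w + g w)"
    and mult: "\<And>f g. f \<in> tensor_carrier X \<Longrightarrow> g \<in> tensor_carrier X \<Longrightarrow> Q f \<Longrightarrow> Q g \<Longrightarrow>
      Q (conv f g)"
  shows "Q f"
proof -
  have word: "Q (delta u)" if "set u \<subseteq> X" for u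
    using that
  proof (induction u)
    case Nil
    show ?case using scalar[of 1] by simp
  next
    case (Cons x u)
    then show ?case
      using mult[of "delta [x]" "delta u"] letter[of x] by (simp add: conv_delta_Cons)
  qed
  have "\<forall>f \<in> tensor_carrier X. {w. f w \<noteq> 0} \<subseteq> W \<longrightarrow> Q f" if "finite W" for W
    using that
  proof (induction W rule: finite_induct)
    case empty
    show ?case
    proof (intro ballI impI)
      fix f :: "'x list \<Rightarrow> 'k" assume "{w. f w \<noteq> 0} \<subseteq> {}"
      then have "f = (\<lambda>w. 0 * delta [] w)" by auto
      then show "Q f" using scalar[of 0] by simp
    qed
  next
    case (insert u W)
    show ?case
    proof (intro ballI impI)
      fix f :: "'x list \<Rightarrow> 'k" assume f: "f \<in> tensor_carrier X" "{w. f w \<noteq> 0} \<subseteq> insert u W"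
      define g where "g = (\<lambda>w. if w = u then 0 else f w)"
      have "{w. g w \<noteq> 0} \<subseteq> {w. f w \<noteq> 0}"
        by (auto simp: g_def)
      with f(1) have g: "g \<in> tensor_carrier X"
        unfolding tensor_carrier_def by (auto intro: finite_subset)
      moreover have "{w. g w \<noteq> 0} \<subseteq> W"
        using f(2) by (auto simp: g_def)
      ultimately have Qg: "Q g"
        using insert.IH by blast
      show "Q f"
      proof (cases "f u = 0")
        case True
        then have "f = g" by (auto simp: g_def)
        with Qg show ?thesis by simp
      next
        case False
        then have u: "set u \<subseteq> X"
          using f(1) by (auto simp: tensor_carrier_def)
        \<comment> \<open>The removed term is written as scalar times word, so that
          \<open>mult\<close> covers it.\<close>
        have f_eq: "f = (\<lambda>w. g w + conv (\<lambda>w. f u * delta [] w) (delta u) w)"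
          by (auto simp: g_def conv_scale_left conv_delta_Nil_left) (auto simp: delta_def)
        show ?thesis
          by (subst f_eq, intro add mult g Qg scalar word u)
            (simp_all add: u)
      qed
    qed
  qed
  with f show ?thesis
    by (auto simp: tensor_carrier_def)
qed

section \<open>Graded modules over the Nichols algebra\<close>

locale nichols_module = rack_constant_cocycle +
  fixes M :: "(('a list \<Rightarrow> 'b) set, 'm::ab_group_add) graded_module"
  assumes graded: "is_graded_module (nichols_algebra X (\<triangleright>) q) M"
begin

text \<open>The module pulled back to the tensor algebra, so that computations use coefficient
  functions instead of cosets.\<close>

definition act :: "('a list \<Rightarrow> 'b) \<Rightarrow> 'm \<Rightarrow> 'm" where
  "act f m = mact M (cl f) m"

lemma left_module: "left_module \<B> M"
  using graded by (simp add: is_graded_module_def)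

lemma act_add_right: "f \<in> tensor_carrier X \<Longrightarrow> act f (m + n) = act f m + act f n"
  using left_module by (simp add: left_module_def act_def carrier_nichols)

lemma act_add_left:
  "f \<in> tensor_carrier X \<Longrightarrow> g \<in> tensor_carrier X \<Longrightarrow> act (\<lambda>w. f w + g w) m = act f m + act g m"
  using left_module by (simp add: left_module_def act_def carrier_nichols flip: add_nichols)

lemma act_conv:
  "f \<in> tensor_carrier X \<Longrightarrow> g \<in> tensor_carrier X \<Longrightarrow> act (conv f g) m = act f (act g m)"
  using left_module by (simp add: left_module_def act_def carrier_nichols flip: mult_nichols)

lemma act_one: "act (delta []) m = m"
  using left_module by (simp add: left_module_def act_def one_nichols)

lemma act_zero_left: "act (\<lambda>w. 0) m = 0"
  using act_add_left[of "\<lambda>w. 0" "\<lambda>w. 0" m] by simp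

lemma act_zero_right: "f \<in> tensor_carrier X \<Longrightarrow> act f 0 = 0"
  using act_add_right[of f 0 0] by simp

lemma act_ideal:
  assumes "f \<in> I"
  shows "act f m = 0"
  using cl_eqI[of "\<lambda>w. 0" f] assms act_zero_left[of m] by (simp add: act_def)

lemma act_delta_Cons:
  "x \<in> X \<Longrightarrow> set u \<subseteq> X \<Longrightarrow> act (delta (x # u)) m = act (delta [x]) (act (delta u) m)"
  using act_conv[of "delta [x]" "delta u" m] by (simp add: conv_delta_Cons)

lemma act_comp:
  assumes "f \<in> tensor_carrier X" and "\<And>w. f w \<noteq> 0 \<Longrightarrow> length w = n" and "m \<in> mcomp M j"
  shows "act f m \<in> mcomp M (int n + j)"
  using graded assms by (auto simp: is_graded_module_def act_def acomp_nichols)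

lemma act_letter: "x \<in> X \<Longrightarrow> m \<in> mcomp M j \<Longrightarrow> act (delta [x]) m \<in> mcomp M (j + 1)"
  using act_comp[of "delta [x]" 1 m j] by (simp add: add.commute)

lemma act_scalar: "m \<in> mcomp M j \<Longrightarrow> act (\<lambda>w. a * delta [] w) m \<in> mcomp M j"
  using act_comp[of "\<lambda>w. a * delta [] w" 0 m j] by simp

lemma act_scalar_commute:
  assumes "f \<in> tensor_carrier X"
  shows "act f (act (\<lambda>w. a * delta [] w) m) = act (\<lambda>w. a * delta [] w) (act f m)"
proof -
  have "conv f (\<lambda>w. a * delta [] w) = (\<lambda>w. a * f w)"
  proof -
    have "conv f (\<lambda>w. a * delta [] w) = (\<lambda>w. a * conv f (delta []) w)"
      by (simp add: conv_def fun_eq_iff sum_distrib_left algebra_simps)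
    then show ?thesis by (simp add: conv_delta_Nil_right)
  qed
  moreover have "conv (\<lambda>w. a * delta [] w) f = (\<lambda>w. a * f w)"
    by (simp add: conv_scale_left conv_delta_Nil_left)
  ultimately show ?thesis
    using assms by (simp flip: act_conv)
qed

lemma mscale_eq: "mscale \<B> M a m = act (\<lambda>w. a * delta [] w) m"
  by (simp add: mscale_def act_def one_nichols smult_nichols)

sublocale vector_space "mscale \<B> M"
proof
  fix a b m n
  show "mscale \<B> M a (m + n) = mscale \<B> M a m + mscale \<B> M a n"
    by (simp add: mscale_eq act_add_right)
  show "mscale \<B> M (a + b) m = mscale \<B> M a m + mscale \<B> M b m"
    by (simp add: mscale_eq algebra_simps flip: act_add_left)
  show "mscale \<B> M a (mscale \<B> M b m) = mscale \<B> M (a * b) m"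
    by (simp add: mscale_eq conv_scale_left conv_delta_Nil_left algebra_simps flip: act_conv)
  show "mscale \<B> M 1 m = m"
    by (simp add: mscale_eq act_one)
qed

section \<open>Homogeneous decompositions and generation in degree 0\<close>

lemma mcomp_zero: "0 \<in> mcomp M i"
  and mcomp_diff: "m \<in> mcomp M i \<Longrightarrow> n \<in> mcomp M i \<Longrightarrow> m - n \<in> mcomp M i"
  using graded by (auto simp: is_graded_module_def add_subgroup_def)

text \<open>Any finite index set containing the support is allowed, so cancellation in differences
  and images needs no separate treatment.\<close>

definition decomp :: "(int \<Rightarrow> 'm) \<Rightarrow> 'm \<Rightarrow> bool" where
  "decomp f m \<longleftrightarrow>
    (\<forall>i. f i \<in> mcomp M i) \<and> (\<exists>J. finite J \<and> (\<forall>i. i \<notin> J \<longrightarrow> f i = 0) \<and> m = (\<Sum>i\<in>J. f i))"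

lemma decomp_iff:
  "decomp f m \<longleftrightarrow> (\<forall>i. f i \<in> mcomp M i) \<and> finite {i. f i \<noteq> 0} \<and> m = (\<Sum>i | f i \<noteq> 0. f i)"
proof
  assume f: "decomp f m"
  then obtain J where J: "finite J" "\<And>i. i \<notin> J \<Longrightarrow> f i = 0" "m = (\<Sum>i\<in>J. f i)"
    by (auto simp: decomp_def)
  then have "{i. f i \<noteq> 0} \<subseteq> J" by auto
  moreover from this have "(\<Sum>i | f i \<noteq> 0. f i) = (\<Sum>i\<in>J. f i)"
    using J(1) by (intro sum.mono_neutral_left) auto
  ultimately show "(\<forall>i. f i \<in> mcomp M i) \<and> finite {i. f i \<noteq> 0} \<and> m = (\<Sum>i | f i \<noteq> 0. f i)"
    using f J by (auto simp: decomp_def intro: finite_subset)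
next
  assume "(\<forall>i. f i \<in> mcomp M i) \<and> finite {i. f i \<noteq> 0} \<and> m = (\<Sum>i | f i \<noteq> 0. f i)"
  then show "decomp f m"
    unfolding decomp_def by (intro conjI exI[of _ "{i. f i \<noteq> 0}"]) auto
qed

lemma decomp_unique: "decomp f m \<Longrightarrow> decomp g m \<Longrightarrow> f = g"
  using graded unfolding is_graded_module_def decomp_iff by metis

lemma decomp_single: "m \<in> mcomp M k \<Longrightarrow> decomp (\<lambda>i. if i = k then m else 0) m"
  unfolding decomp_def by (intro conjI exI[of _ "{k}"]) (auto simp: mcomp_zero)

lemma decomp_zero: "decomp (\<lambda>i. 0) 0"
  unfolding decomp_def by (intro conjI exI[of _ "{}"]) (auto simp: mcomp_zero)

lemma decomp_diff:
  assumes "decomp f m" and "decomp g n"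
  shows "decomp (\<lambda>i. f i - g i) (m - n)"
proof -
  obtain J K where J: "finite J" "\<And>i. i \<notin> J \<Longrightarrow> f i = 0" "m = (\<Sum>i\<in>J. f i)"
    and K: "finite K" "\<And>i. i \<notin> K \<Longrightarrow> g i = 0" "n = (\<Sum>i\<in>K. g i)"
    using assms by (auto simp: decomp_def)
  have "(\<Sum>i\<in>J. f i) = (\<Sum>i\<in>J \<union> K. f i)" "(\<Sum>i\<in>K. g i) = (\<Sum>i\<in>J \<union> K. g i)"
    using J K by (auto intro: sum.mono_neutral_left)
  then show ?thesis
    unfolding decomp_def using assms J K
    by (intro conjI exI[of _ "J \<union> K"]) (auto simp: decomp_def sum_subtractf mcomp_diff)
qed

lemma act_sum: "f \<in> tensor_carrier X \<Longrightarrow> finite J \<Longrightarrow> act f (\<Sum>i\<in>J. g i) = (\<Sum>i\<in>J. act f (g i))"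
  by (induction J rule: infinite_finite_induct) (auto simp: act_zero_right act_add_right)

lemma decomp_act:
  assumes "decomp g m" and "f \<in> tensor_carrier X"
    and "\<And>i n. n \<in> mcomp M i \<Longrightarrow> act f n \<in> mcomp M (i + s)"
  shows "decomp (\<lambda>i. act f (g (i - s))) (act f m)"
proof -
  obtain J where J: "finite J" "\<And>i. i \<notin> J \<Longrightarrow> g i = 0" "m = (\<Sum>i\<in>J. g i)"
    using assms by (auto simp: decomp_def)
  have "act f m = (\<Sum>i\<in>(\<lambda>i. i + s) ` J. act f (g (i - s)))"
    using J assms(2) by (simp add: act_sum sum.reindex inj_on_def)
  moreover have "act f (g (i - s)) \<in> mcomp M i" for i
    using assms(1) assms(3)[of "g (i - s)" "i - s"] by (simp add: decomp_def)
  moreover have "act f (g (i - s)) = 0" if "i \<notin> (\<lambda>i. i + s) ` J" for i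
  proof -
    have "i - s \<notin> J" using that by force
    then show ?thesis using J(2) assms(2) by (simp add: act_zero_right)
  qed
  ultimately show ?thesis
    unfolding decomp_def using J(1) by (intro conjI exI[of _ "(\<lambda>i. i + s) ` J"]) auto
qed

text \<open>If no letter maps \<open>M\<^sub>k\<^sub>-\<^sub>1\<close> nontrivially to \<open>M\<^sub>k\<close>, the sum of the other components is a
  submodule.\<close>

lemma nonzero_letter_action:
  assumes gen: "generated_in_degree_0 \<B> M" and k: "k \<noteq> 0"
    and u: "u \<in> mcomp M k" "u \<noteq> 0"
  shows "\<exists>x\<in>X. \<exists>m\<in>mcomp M (k - 1). act (delta [x]) m \<noteq> 0"
proof (rule ccontr)
  assume "\<not> ?thesis"
  then have kill: "act (delta [x]) m = 0" if "x \<in> X" "m \<in> mcomp M (k - 1)" for x m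
    using that by auto
  define N where "N = {m. \<exists>f. decomp f m \<and> f k = 0}"
  have sub: "add_subgroup N"
    unfolding add_subgroup_def
  proof (intro conjI ballI)
    show "0 \<in> N" using decomp_zero by (auto simp: N_def)
    fix m n assume "m \<in> N" "n \<in> N"
    then obtain f g where "decomp f m" "f k = 0" "decomp g n" "g k = 0"
      by (auto simp: N_def)
    then show "m - n \<in> N"
      unfolding N_def using decomp_diff by (intro CollectI exI[of _ "\<lambda>i. f i - g i"]) auto
  qed
  then have N_add: "m + n \<in> N" if "m \<in> N" "n \<in> N" for m n
    using that unfolding add_subgroup_def by (metis diff_0 diff_minus_eq_add)
  have "\<forall>m\<in>N. act f m \<in> N" if "f \<in> tensor_carrier X" for f
    using that
  proof (induction f rule: tensor_induct)
    case (scalar a)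
    show ?case
    proof
      fix m assume "m \<in> N"
      then obtain g where g: "decomp g m" "g k = 0" by (auto simp: N_def)
      have "decomp (\<lambda>i. act (\<lambda>w. a * delta [] w) (g (i - 0))) (act (\<lambda>w. a * delta [] w) m)"
        using act_scalar by (intro decomp_act[OF g(1)]) auto
      with g(2) show "act (\<lambda>w. a * delta [] w) m \<in> N"
        unfolding N_def using act_zero_right[of "\<lambda>w. a * delta [] w"]
        by (intro CollectI exI[of _ "\<lambda>i. act (\<lambda>w. a * delta [] w) (g i)"]) auto
    qed
  next
    case (letter x)
    show ?case
    proof
      fix m assume "m \<in> N"
      then obtain g where g: "decomp g m" "g k = 0" by (auto simp: N_def)
      have "decomp (\<lambda>i. act (delta [x]) (g (i - 1))) (act (delta [x]) m)"
        using letter by (intro decomp_act[OF g(1)] act_letter) auto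
      \<comment> \<open>The degree \<open>k\<close> part of the image comes from degree
        \<open>k - 1\<close>, where letters act as zero.\<close>
      moreover have "act (delta [x]) (g (k - 1)) = 0"
        using g(1) letter by (intro kill) (auto simp: decomp_def)
      ultimately show "act (delta [x]) m \<in> N"
        unfolding N_def by (intro CollectI exI conjI)
    qed
  qed (auto simp: act_add_left act_conv N_add)
  then have "\<forall>a\<in>carrier \<B>. \<forall>m\<in>N. mact M a m \<in> N"
    by (auto simp: carrier_nichols act_def)
  moreover have "mcomp M 0 \<subseteq> N"
  proof
    fix m assume "m \<in> mcomp M 0"
    from decomp_single[OF this] k show "m \<in> N"
      unfolding N_def by (intro CollectI exI[of _ "\<lambda>i. if i = 0 then m else 0"]) auto
  qed
  ultimately have "N = UNIV"
    using gen sub by (auto simp: generated_in_degree_0_def)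
  then obtain f where f: "decomp f u" "f k = 0"
    by (auto simp: N_def)
  \<comment> \<open>By uniqueness the degree \<open>k\<close> part of \<open>u\<close> is
    \<open>u\<close> itself, contradicting \<open>f k = 0\<close>.\<close>
  have "f = (\<lambda>i. if i = k then u else 0)"
    by (rule decomp_unique[OF f(1) decomp_single[OF u(1)]])
  with f(2) u(2) show False by simp
qed

lemma dim_one:
  assumes "dim (mcomp M i) = 1"
  obtains b where "b \<in> mcomp M i" "b \<noteq> 0" "\<And>m. m \<in> mcomp M i \<Longrightarrow> \<exists>a. m = mscale \<B> M a b"
proof -
  obtain B where B: "B \<subseteq> mcomp M i" "independent B" "mcomp M i \<subseteq> span B" "card B = 1"
    using basis_exists[of "mcomp M i"] assms by metis
  then obtain b where b: "B = {b}"
    by (auto simp: card_1_singleton_iff)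
  show ?thesis
  proof (rule that[of b])
    show "b \<in> mcomp M i" using B(1) b by simp
    show "b \<noteq> 0" using B(2) b dependent_zero by blast
    show "\<exists>a. m = mscale \<B> M a b" if "m \<in> mcomp M i" for m
      using B(3) b that by (auto simp: span_singleton)
  qed
qed

text \<open>On a line \<open>v\<close> is a scalar multiple of the nonzero \<open>u\<close>, and
  scalars commute with \<open>f\<close>.\<close>

lemma act_zero_of_dim_one:
  assumes dim: "dim (mcomp M i) = 1" and f: "f \<in> tensor_carrier X"
    and u: "u \<in> mcomp M i" "u \<noteq> 0" "act f u = 0" and v: "v \<in> mcomp M i"
  shows "act f v = 0"
proof -
  obtain b where "\<And>m. m \<in> mcomp M i \<Longrightarrow> \<exists>a. m = mscale \<B> M a b"
    using dim_one[OF dim] by metis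
  then obtain a a' where ua: "u = mscale \<B> M a b" and va: "v = mscale \<B> M a' b"
    using u v by metis
  have "a \<noteq> 0" using ua u(2) by auto
  then have v_eq: "v = mscale \<B> M (a' / a) u"
    using ua va by simp
  show ?thesis
    unfolding v_eq mscale_eq act_scalar_commute[OF f] u(3)
    by (intro act_zero_right tensor_carrier_scale tensor_carrier_delta) simp
qed

text \<open>The membership claim is what \<open>act_add_left\<close> requires in the
  induction.\<close>

lemma act_sum_delta:
  assumes "finite W" and "\<And>w. w \<in> W \<Longrightarrow> set w \<subseteq> X"
  shows "act (\<lambda>w. if w \<in> W then 1 else 0) m = (\<Sum>w\<in>W. act (delta w) m) \<and>
    (\<lambda>w. if w \<in> W then 1 else 0 :: 'b) \<in> tensor_carrier X"
  using assms
proof (induction W rule: finite_induct)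
  case (insert u W)
  have eq: "(\<lambda>w. if w \<in> insert u W then 1 else 0 :: 'b) =
      (\<lambda>w. delta u w + (if w \<in> W then 1 else 0))"
    using insert.hyps by (auto simp: delta_def)
  show ?case
    unfolding eq using insert by (simp add: act_add_left)
qed (simp add: act_zero_left)

end

section \<open>Quadratic relations from orbits of the braiding\<close>

context rack_constant_cocycle
begin

text \<open>For \<open>\<kappa> = - 1\<close>, I + c_1 gives at \<open>w\<close> the difference of
  the indicator values at \<open>w\<close> and at its preimage, which agree as \<open>W\<close> is
  stable.\<close>

lemma orbit_relation:
  assumes W: "finite W" "\<And>w. w \<in> W \<Longrightarrow> set w \<subseteq> X \<and> length w = 2"
    and orbit: "braid_word (\<triangleright>) (Suc 0) ` W = W" and \<kappa>: "\<kappa> = - 1"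
  shows "(\<lambda>w. if w \<in> W then 1 else 0) \<in> I"
  unfolding nichols_ideal_iff
proof (intro conjI allI)
  let ?f = "\<lambda>w. if w \<in> W then 1 else 0 :: 'k"
  show "?f \<in> tensor_carrier X"
    using W by (auto simp: tensor_carrier_def intro: finite_subset[of _ W] split: if_splits)
  fix w
  show "S (length w) ?f w = 0"
  proof (cases "length w = 2")
    case True
    then obtain a b where w: "w = [a, b]"
      by (auto simp: numeral_2_eq_2 length_Suc_conv)
    have iff: "unbraid 0 w \<in> W \<longleftrightarrow> w \<in> W"
    proof
      assume u: "unbraid 0 w \<in> W"
      then have "braid_word (\<triangleright>) (Suc 0) (unbraid 0 w) = w"
        using W(2)[OF u] True by (subst braid_word_eq_iff) auto
      with u orbit show "w \<in> W" by (metis imageI)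
    next
      assume "w \<in> W"
      with orbit obtain u where u: "u \<in> W" "braid_word (\<triangleright>) (Suc 0) u = w"
        by (metis imageE)
      then have "u = unbraid 0 w"
        using W(2)[OF u(1)] True by (subst braid_word_eq_iff[symmetric]) auto
      with u show "unbraid 0 w \<in> W" by simp
    qed
    have "S (length w) ?f w = T 1 ?f w"
      by (simp add: w T_0)
    also have "\<dots> = ?f w + c 0 ?f w"
      by (simp add: T_def)
    also have "c 0 ?f w = \<kappa> * ?f (unbraid 0 w)"
      using True by (intro c_unbraid) simp
    finally show ?thesis
      using iff \<kappa> by simp
  next
    case False
    then show ?thesis
      using W(2) by (intro braid_op_vanish[OF braid_op_S]) auto
  qed
qed

end

context braided_rack
begin

lemma braid_orbit:
  assumes "x \<in> X" "y \<in> X" "x \<noteq> y"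
  obtains W where "finite W" "[y, x] \<in> W" "braid_word (\<triangleright>) (Suc 0) ` W = W"
    "\<And>w. w \<in> W \<Longrightarrow> w = [y, x] \<or> (\<exists>z\<in>X. w = [x, z] \<or> w = [z, y])"
proof (cases "y \<triangleright> x = x")
  case True
  \<comment> \<open>Otherwise \<open>x \<triangleright> (y \<triangleright> x) = y\<close>, but here
    the left side is \<open>x \<triangleright> x = x\<close>.\<close>
  then have "x \<triangleright> y = y"
    using braided[of x y] idem assms by auto
  with True assms show ?thesis
    by (intro that[of "{[y, x], [x, y]}"]) (auto simp: braid_word_def)
next
  case False
  let ?w = "y \<triangleright> x"
  have yx: "y \<triangleright> (x \<triangleright> y) = x"
    using braided[of y x] False assms by auto
  have "?w \<triangleright> y = y \<triangleright> (x \<triangleright> y)"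
    using self_distrib[of y x y] idem assms by simp
  then have 1: "?w \<triangleright> y = x" using yx by simp
  \<comment> \<open>Equality would turn \<open>yx\<close> into \<open>y = x\<close>.\<close>
  have "x \<triangleright> y \<noteq> y"
    using yx idem assms by auto
  then have 2: "x \<triangleright> ?w = y"
    using braided[of x y] assms by auto
  show ?thesis
    \<comment> \<open>The braiding runs through the cycle \<open>[y, x]\<close>,
      \<open>[?w, y]\<close>, \<open>[x, ?w]\<close> and back.\<close>
    using 1 2 assms by (intro that[of "{[y, x], [?w, y], [x, ?w]}"]) (auto simp: braid_word_def)
qed

end

section \<open>Nonexistence of 2-truncated point modules\<close>

lemma no_2_truncated_point_module:
  fixes q :: "'x \<Rightarrow> 'x \<Rightarrow> 'k::field"
    and M :: "(('x list \<Rightarrow> 'k) set, 'm::ab_group_add) graded_module"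
  assumes "braided_rack X tri" and q: "\<And>x y. x \<in> X \<Longrightarrow> y \<in> X \<Longrightarrow> q x y = - 1"
  shows "\<not> truncated_point_module 2 (nichols_algebra X tri q) M"
proof
  assume M: "truncated_point_module 2 (nichols_algebra X tri q) M"
  interpret braided_rack X tri by fact
  interpret nichols_module X tri q "- 1" M
    using q M by unfold_locales (auto simp: truncated_point_module_def)
  have gen: "generated_in_degree_0 \<B> M"
    using M by (simp add: truncated_point_module_def)
  have dim: "dim (mcomp M 1) = 1" "dim (mcomp M 2) = 1"
    using M by (force simp: truncated_point_module_def)+
  obtain u where u: "u \<in> mcomp M 1" "u \<noteq> 0"
    using dim_one[OF dim(1)] by metis
  obtain u' where u': "u' \<in> mcomp M 2" "u' \<noteq> 0"
    using dim_one[OF dim(2)] by metis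
  obtain x m0 where x: "x \<in> X" "m0 \<in> mcomp M 0" "act (delta [x]) m0 \<noteq> 0"
    using nonzero_letter_action[OF gen _ u] by auto
  obtain y m1 where y: "y \<in> X" "m1 \<in> mcomp M 1" "act (delta [y]) m1 \<noteq> 0"
    using nonzero_letter_action[OF gen _ u'] by auto
  have deg1: "act (delta [z]) m0 \<in> mcomp M 1" if "z \<in> X" for z
    using act_letter[OF that x(2)] by simp
  have relation: "(\<Sum>w\<in>W. act (delta w) m0) = 0"
    if "finite W" "\<And>w. w \<in> W \<Longrightarrow> set w \<subseteq> X \<and> length w = 2" "braid_word tri (Suc 0) ` W = W" for W
    using act_sum_delta[of W m0] act_ideal[OF orbit_relation[OF that], of m0] that(1,2) by simp
  have square: "act (delta [z]) (act (delta [z]) m0) = 0" if "z \<in> X" for z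
    using relation[of "{[z, z]}"] that idem
    by (simp add: braid_word_def act_delta_Cons[of _ "[_]"])
  have x_kills: "act (delta [x]) v = 0" if "v \<in> mcomp M 1" for v
    by (rule act_zero_of_dim_one[OF dim(1) _ deg1[OF x(1)] x(3) square[OF x(1)] that])
      (simp add: x(1))
  \<comment> \<open>If \<open>y\<close> did not kill \<open>m0\<close>, then y m0 would span degree
    1 and be killed by \<open>y\<close>, forcing \<open>y\<close> to kill \<open>m1\<close>.\<close>
  have y_kills: "act (delta [y]) m0 = 0"
    using act_zero_of_dim_one[OF dim(1) _ deg1[OF y(1)] _ square[OF y(1)] y(2)] y(1,3) by auto
  have "x \<noteq> y"
    using x(3) y_kills by auto
  obtain W where W: "finite W" "[y, x] \<in> W" "braid_word tri (Suc 0) ` W = W"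
    "\<And>w. w \<in> W \<Longrightarrow> w = [y, x] \<or> (\<exists>z\<in>X. w = [x, z] \<or> w = [z, y])"
    using braid_orbit[OF x(1) y(1) \<open>x \<noteq> y\<close>] by blast
  have "act (delta w) m0 = 0" if "w \<in> W" "w \<noteq> [y, x]" for w
    using W(4)[OF that(1)] that(2) x(1) y(1)
    by (auto simp: act_delta_Cons[of _ "[_]"] y_kills act_zero_right intro!: x_kills deg1)
  then have "(\<Sum>w\<in>W. act (delta w) m0) = act (delta [y, x]) m0"
    using W(1,2) by (subst sum.remove[of _ "[y, x]"]) auto
  moreover have "(\<Sum>w\<in>W. act (delta w) m0) = 0"
    using W(4) x(1) y(1) by (intro relation W(1,3)) fastforce
  ultimately have "act (delta [y]) (act (delta [x]) m0) = 0"
    using x(1) y(1) by (simp add: act_delta_Cons[of _ "[_]"])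
  then have "act (delta [y]) m1 = 0"
    by (intro act_zero_of_dim_one[OF dim(1) _ deg1[OF x(1)] x(3) _ y(2)]) (simp add: y(1))
  with y(3) show False by contradiction
qed

theorem proposition1p2:
  fixes X :: "'x set" and tri :: "'x \<Rightarrow> 'x \<Rightarrow> 'x"
    and G :: "('g, 'h) monoid_scheme"
    and q :: "'x \<Rightarrow> 'x \<Rightarrow> 'k::field"
  assumes "finite X" and "braided_rack X tri"
    and "of_conjugacy_type G X tri"
    and "rack_2_cocycle X tri q"
    and "\<And>x y. \<lbrakk>x \<in> X; y \<in> X\<rbrakk> \<Longrightarrow> q x y = -1"
  shows "(Gamma_trunc 2 (nichols_algebra X tri q)
            :: (('x list \<Rightarrow> 'k) set, 'm::ab_group_add) graded_module set set) = {}"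
  \<comment> \<open>A quotient of the empty set is empty.\<close>
  using no_2_truncated_point_module[of X tri q] assms(2,5)
  by (auto simp: Gamma_trunc_def quotient_def)

end
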